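(* Let $\Omega$, $N$, $r_1<\dots<r_N$, $\alpha_\ell$, $\{w_j^{(\ell)}\}_{j\in\mathbb{Z}}$ and the operators $T_{n,\ell}$ on $\ell_2(C_0(\Omega))$ ($n\in\mathbb{N}$, $\ell\in\{1,\dots,N\}$) be as in the context, and let $\mathcal{F}$ be the family of all infinite subsets of $\mathbb{N}$. Then the following statements are equivalent. (1) The sequences of operators $\{T_{n,1}\}_{n\in\mathbb{N}},\dots,\{T_{n,N}\}_{n\in\mathbb{N}}$ are $d\mathcal{F}$-semi-transitive on $\ell_2(C_0(\Omega))$. (2) For every $J\in\mathbb{N}$ and each compact subset $K$ of $\Omega$ there exists a strictly increasing sequence $\{n_k\}_k\subseteq\mathbb{N}$ such that $$\lim_{k\to\infty}\Bigg(\sup_{t\in K}\frac{1}{\prod_{i=1}^{r_sn_k}\big(w^{(s)}_{j+i-r_sn_k}\circ\alpha_s^{r_sn_k-i}\big)(t)}\Bigg)\cdot\Bigg(\sup_{t\in K}\prod_{i=1}^{r_\ell n_k}\big(w^{(\ell)}_{j+i}\circ\alpha_\ell^{-i}\big)(t)\Bigg)=0$$ for all $j\in\mathbb{Z}$ with $-J\le j\le J$ and all $\ell,s\in\{1,\dots,N\}$; and moreover, for all distinct $s,\ell\in\{1,\dots,N\}$ and all $j\in\mathbb{Z}$ with $-J\le j\le J$, $$\lim_{k\to\infty}\Bigg(\sup_{t\in K}\frac{\prod_{i=1}^{r_\ell n_k}\big(w^{(\ell)}_{j-r_sn_k+i}\circ\alpha_\ell^{-i}\circ\alpha_s^{r_sn_k}\big)(t)}{\prod_{i=1}^{r_sn_k}\big(w^{(s)}_{j-r_sn_k+i}\circ\alpha_s^{r_sn_k-i}\big)(t)}\Bigg)=0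 .$$
   Context: $\Omega$ is a locally compact, non-compact Hausdorff space; $C_b(\Omega)$ and $C_0(\Omega)$ are the spaces of bounded continuous functions on $\Omega$ and of continuous functions on $\Omega$ vanishing at infinity, both with the supremum norm $\|\cdot\|_\infty$. $\ell_2(C_0(\Omega))$ is the standard Hilbert $C_0(\Omega)$-module indexed by $\mathbb{Z}$: sequences $\{f_j\}_{j\in\mathbb{Z}}$ in $C_0(\Omega)$ such that $\sum_j|f_j|^2$ converges in norm, with norm $\|\sum_j|f_j|^2\|_\infty^{1/2}$. $N\in\mathbb{N}$ and $r_1,\dots,r_N\in\mathbb{N}$ with $r_1<r_2<\dots<r_N$. $\alpha_1,\dots,\alpha_N$ are homeomorphisms of $\Omega$ (powers of $\alpha_\ell$ denote iterates). For $\ell\in\{1,\dots,N\}$, $\{w_j^{(\ell)}\}_{j\in\mathbb{Z}}\subseteq C_b(\Omega)$ with $w_j^{(\ell)}>0$ on $\Omega$ for all $j$, and there is $M>0$ with $\|w_j^{(\ell)}\|_\infty<M$ for all $j\in\mathbb{Z}$, $\ell\in\{1,\dots,N\}$. For $n\in\mathbb{N}$ and $\ell\in\{1,\dots,N\}$, $T_{n,\ell}$ is the bounded linear operator on $\ell_2(C_0(\Omega))$ given by $T_{n,\ell}(a)=b_{n,\ell}\,\Phi_{n,\ell}(a)$ (componentwise product), where $$(\Phi_{n,\ell}(\{f_j\}_{j\in\mathbb{Z}}))_j=f_{j-r_\ell n}\circ\alpha_\ell^{r_\ell n},\qquad (b_{n,\ell})_{j+r_\ell n}=\prod_{k=1}^{r_\ell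 n}\big(w^{(\ell)}_{j+k}\circ\alpha_\ell^{r_\ell n-k}\big)\qquad(j\in\mathbb{Z}).$$ Definition. Families $\{T_{n,1}\}_{n\in\mathbb{N}},\dots,\{T_{n,N}\}_{n\in\mathbb{N}}$ of bounded linear operators on a Banach space $X$ are $d\mathcal{F}$-semi-transitive if for all non-empty open subsets $\mathcal{O},V_1,\dots,V_N$ of $X$ there is some $F\in\mathcal{F}$ such that for every $n\in F$ there is a real $\lambda_n>0$ with $$\mathcal{O}\cap\lambda_nT_{n,1}^{-1}(V_1)\cap\dots\cap\lambda_nT_{n,N}^{-1}(V_N)\neq\varnothing,$$ where $T_{n,\ell}^{-1}(V_\ell)$ denotes the preimage. *)

theory Defs
  imports "HOL-Analysis.Analysis"
begin

section \<open>Functions vanishing at infinity\<close>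

definition c0fun :: "('a::topological_space \<Rightarrow>\<^sub>C complex) set" where
  "c0fun = {f. \<forall>e>0. \<exists>K. compact K \<and> (\<forall>t. t \<notin> K \<longrightarrow> cmod (apply_bcontfun f t) < e)}"

definition cmod_sq :: "('a::topological_space \<Rightarrow>\<^sub>C complex) \<Rightarrow> ('a \<Rightarrow>\<^sub>C real)" where
  "cmod_sq f = Bcontfun (\<lambda>t. (cmod (f t))\<^sup>2)"

lemma apply_cmod_sq [simp]: "apply_bcontfun (cmod_sq f) t = (cmod (f t))\<^sup>2"
proof -
  have "(\<lambda>t. (cmod (f t))\<^sup>2) \<in> bcontfun"
  proof (rule bcontfun_normI)
    show "continuous_on UNIV (\<lambda>t. (cmod (f t))\<^sup>2)"
      by (intro continuous_intros) auto
    show "norm ((cmod (f t))\<^sup>2) \<le> (norm f)\<^sup>2" for t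
      by (simp add: norm_bounded power_mono)
  qed
  then show ?thesis
    by (simp add: cmod_sq_def Bcontfun_inverse)
qed

lemma apply_bcontfun_sum:
  "apply_bcontfun (sum g F) t = (\<Sum>j\<in>F. apply_bcontfun (g j) t)"
  for g :: "'i \<Rightarrow> 'a::topological_space \<Rightarrow>\<^sub>C 'b::real_normed_vector"
  by (induction F rule: infinite_finite_induct) auto

lemma zero_c0fun: "0 \<in> c0fun"
  by (auto simp: c0fun_def intro: exI[of _ "{}"])

lemma add_c0fun:
  assumes "f \<in> c0fun" "g \<in> c0fun"
  shows "f + g \<in> c0fun"
  unfolding c0fun_def
proof safe
  fix e :: real assume "e > 0"
  then have "e / 2 > 0" by simp
  with assms obtain K L where "compact K" "\<And>t. t \<notin> K \<Longrightarrow> cmod (f t) < e / 2"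
      "compact L" "\<And>t. t \<notin> L \<Longrightarrow> cmod (g t) < e / 2"
    unfolding c0fun_def by blast
  then show "\<exists>K. compact K \<and> (\<forall>t. t \<notin> K \<longrightarrow> cmod ((f + g) t) < e)"
    by (intro exI[of _ "K \<union> L"]) (auto intro!: norm_triangle_lt simp: field_sum_of_halves
        intro: add_strict_mono[of _ "e/2" _ "e/2", simplified])
qed

lemma scaleR_c0fun:
  assumes "f \<in> c0fun"
  shows "c *\<^sub>R f \<in> c0fun"
  unfolding c0fun_def
proof safe
  fix e :: real assume e: "e > 0"
  then have "e / (\<bar>c\<bar> + 1) > 0" by simp
  with assms obtain K where K: "compact K" "\<And>t. t \<notin> K \<Longrightarrow> cmod (f t) < e / (\<bar>c\<bar> + 1)"
    unfolding c0fun_def by blast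
  have "cmod ((c *\<^sub>R f) t) < e" if "t \<notin> K" for t
  proof -
    have "(\<bar>c\<bar> + 1) * cmod (f t) < e"
      using K(2)[OF that] by (simp add: field_simps)
    moreover have "\<bar>c\<bar> * cmod (f t) \<le> (\<bar>c\<bar> + 1) * cmod (f t)"
      by (simp add: mult_right_mono)
    ultimately show ?thesis by simp
  qed
  with K show "\<exists>K. compact K \<and> (\<forall>t. t \<notin> K \<longrightarrow> cmod ((c *\<^sub>R f) t) < e)"
    by blast
qed

lemma summable_on_bcontfun_iff:
  fixes g :: "'i \<Rightarrow> 'a::topological_space \<Rightarrow>\<^sub>C real"
  assumes nn: "\<And>j t. 0 \<le> g j t"
  shows "g summable_on UNIV \<longleftrightarrow>
    (\<forall>e>0. \<exists>F0. finite F0 \<and> (\<forall>F t. finite F \<and> F \<inter> F0 = {} \<longrightarrow> (\<Sum>j\<in>F. g j t) \<le> e))"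
    (is "_ \<longleftrightarrow> ?C")
proof
  assume "g summable_on UNIV"
  then have S: "(sum g \<longlongrightarrow> infsum g UNIV) (finite_subsets_at_top UNIV)"
    by (rule infsum_tendsto)
  define S where "S = infsum g UNIV"
  note S = S[folded S_def]
  show ?C
  proof safe
    fix e :: real assume "e > 0"
    then have "\<forall>\<^sub>F F in finite_subsets_at_top UNIV. dist (sum g F) S < e / 2"
      by (intro tendstoD[OF S]) simp
    then obtain F0 where F0: "finite F0"
        "\<forall>F. finite F \<and> F0 \<subseteq> F \<and> F \<subseteq> UNIV \<longrightarrow> dist (sum g F) S < e / 2"
      unfolding eventually_finite_subsets_at_top by (elim exE conjE) (rule that)
    have "(\<Sum>j\<in>F. g j t) \<le> e" if "finite F" "F \<inter> F0 = {}" for F t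
    proof -
      have "sum g F = sum g (F0 \<union> F) - sum g F0"
        using that F0(1) by (subst sum.union_disjoint) auto
      moreover have "dist (sum g (F0 \<union> F)) (sum g F0) < e"
        using F0 that by (intro dist_triangle_half_l[of "sum g (F0 \<union> F)" S e "sum g F0"]) auto
      ultimately have "norm (sum g F) < e"
        by (simp only: dist_norm)
      then show ?thesis
        using norm_bounded[of "sum g F" t] by (simp add: apply_bcontfun_sum)
    qed
    with F0(1) show "\<exists>F0. finite F0 \<and> (\<forall>F t. finite F \<and> F \<inter> F0 = {} \<longrightarrow> (\<Sum>j\<in>F. g j t) \<le> e)"
      by (intro exI[of _ F0]) simp
  qed
next
  assume C: ?C
  have sm: "(\<lambda>j. g j t) summable_on UNIV" for t
  proof (rule nonneg_bdd_above_summable_on)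
    from C[rule_format, OF zero_less_one] obtain F0 where F0: "finite F0"
        "\<And>F. finite F \<Longrightarrow> F \<inter> F0 = {} \<Longrightarrow> (\<Sum>j\<in>F. g j t) \<le> 1"
      by blast
    have "(\<Sum>j\<in>F. g j t) \<le> (\<Sum>j\<in>F0. g j t) + 1" if "finite F" for F
    proof -
      have "(\<Sum>j\<in>F. g j t) = (\<Sum>j\<in>F \<inter> F0. g j t) + (\<Sum>j\<in>F - F0. g j t)"
        using that by (rule sum.Int_Diff)
      moreover have "(\<Sum>j\<in>F \<inter> F0. g j t) \<le> (\<Sum>j\<in>F0. g j t)"
        using F0 nn by (intro sum_mono2) auto
      moreover have "(\<Sum>j\<in>F - F0. g j t) \<le> 1"
        using that by (intro F0) auto
      ultimately show ?thesis by simp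
    qed
    then show "bdd_above (sum (\<lambda>j. g j t) ` {F. F \<subseteq> UNIV \<and> finite F})"
      by (auto intro!: bdd_aboveI[of _ "(\<Sum>j\<in>F0. g j t) + 1"])
  qed (use nn in auto)
  have "uniform_limit UNIV (\<lambda>F. apply_bcontfun (sum g F)) (\<lambda>t. infsum (\<lambda>j. g j t) UNIV)
      (finite_subsets_at_top UNIV)"
  proof (rule uniform_limitI)
    fix e :: real assume "e > 0"
    then have "e / 2 > 0" by simp
    from C[rule_format, OF this] obtain F0 where F0: "finite F0"
        "\<And>F t. finite F \<Longrightarrow> F \<inter> F0 = {} \<Longrightarrow> (\<Sum>j\<in>F. g j t) \<le> e / 2"
      by blast
    have "dist (sum g F t) (infsum (\<lambda>j. g j t) UNIV) < e" if F: "finite F" "F0 \<subseteq> F" for F t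
    proof -
      have 1: "(\<Sum>j\<in>F. g j t) \<le> infsum (\<lambda>j. g j t) UNIV"
        using sm nn F by (intro finite_sum_le_infsum) auto
      have "infsum (\<lambda>j. g j t) UNIV \<le> (\<Sum>j\<in>F. g j t) + e / 2"
      proof (rule infsum_le_finite_sums[OF sm])
        fix G :: "'i set" assume G: "finite G"
        have "(\<Sum>j\<in>G. g j t) = (\<Sum>j\<in>G \<inter> F. g j t) + (\<Sum>j\<in>G - F. g j t)"
          using G by (rule sum.Int_Diff)
        moreover have "(\<Sum>j\<in>G \<inter> F. g j t) \<le> (\<Sum>j\<in>F. g j t)"
          using F nn by (intro sum_mono2) auto
        moreover have "(\<Sum>j\<in>G - F. g j t) \<le> e / 2"
          using G F by (intro F0) auto
        ultimately show "(\<Sum>j\<in>G. g j t) \<le> (\<Sum>j\<in>F. g j t) + e / 2" by simp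
      qed
      with 1 \<open>e > 0\<close> show ?thesis
        by (simp add: apply_bcontfun_sum dist_real_def)
    qed
    with F0(1) show "\<forall>\<^sub>F F in finite_subsets_at_top UNIV.
        \<forall>t\<in>UNIV. dist (sum g F t) (infsum (\<lambda>j. g j t) UNIV) < e"
      unfolding eventually_finite_subsets_at_top by (intro exI[of _ F0]) auto
  qed
  then obtain l' where "(sum g \<longlongrightarrow> l') (finite_subsets_at_top UNIV)"
    by (rule uniform_limit_bcontfunE) simp
  then show "g summable_on UNIV"
    unfolding summable_on_def has_sum_def by blast
qed

section \<open>The standard Hilbert module over the functions vanishing at infinity\<close>

text \<open>
  Convergence of the series in norm is summability (along finite subsets of the index set) in the
  space of bounded continuous functions with the supremum norm; as all terms are non-negative,
  this agrees with convergence of the partial sums in any order.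
\<close>

definition l2c0_seqs :: "(int \<Rightarrow> 'a::topological_space \<Rightarrow>\<^sub>C complex) set" where
  "l2c0_seqs = {f. (\<forall>j. f j \<in> c0fun) \<and> (\<lambda>j. cmod_sq (f j)) summable_on UNIV}"

lemma l2c0_seqs_iff:
  "f \<in> l2c0_seqs \<longleftrightarrow> (\<forall>j. f j \<in> c0fun) \<and>
    (\<forall>e>0. \<exists>F0. finite F0 \<and>
      (\<forall>F t. finite F \<and> F \<inter> F0 = {} \<longrightarrow> L2_set (\<lambda>j. cmod (f j t)) F \<le> e))"
    (is "_ \<longleftrightarrow> _ \<and> ?R")
proof -
  have "(\<lambda>j. cmod_sq (f j)) summable_on UNIV \<longleftrightarrow> 
    (\<forall>e>0. \<exists>F0. finite F0 \<and> 
       (\<forall>F t. finite F \<and> F \<inter> F0 = {} \<longrightarrow> (\<Sum>j\<in>F. (cmod (f j t))\<^sup>2) \<le> e))" (is "_ \<longleftrightarrow> ?L")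
    by (subst summable_on_bcontfun_iff) auto
  also have "?L \<longleftrightarrow> ?R"
  proof
    assume L: ?L
    show ?R
    proof safe
      fix e :: real assume "e > 0"
      then have "e\<^sup>2 > 0" by simp
      from L[rule_format, OF this] obtain F0 where F0: "finite F0"
          "\<forall>F t. finite F \<and> F \<inter> F0 = {} \<longrightarrow> (\<Sum>j\<in>F. (cmod (f j t))\<^sup>2) \<le> e\<^sup>2"
        by blast
      then show "\<exists>F0. finite F0 \<and>
          (\<forall>F t. finite F \<and> F \<inter> F0 = {} \<longrightarrow> L2_set (\<lambda>j. cmod (f j t)) F \<le> e)"
        using \<open>e > 0\<close> unfolding L2_set_def
        by (intro exI[of _ F0] conjI allI impI real_le_lsqrt) simp_all
    qed
  next
    assume R: ?R
    show ?L
    proof safe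
      fix e :: real assume "e > 0"
      then have "sqrt e > 0" by simp
      from R[rule_format, OF this] obtain F0 where F0: "finite F0"
          "\<forall>F t. finite F \<and> F \<inter> F0 = {} \<longrightarrow> L2_set (\<lambda>j. cmod (f j t)) F \<le> sqrt e"
        by blast
      then show "\<exists>F0. finite F0 \<and>
          (\<forall>F t. finite F \<and> F \<inter> F0 = {} \<longrightarrow> (\<Sum>j\<in>F. (cmod (f j t))\<^sup>2) \<le> e)"
        unfolding L2_set_def by (intro exI[of _ F0]) simp
    qed
  qed
  finally show ?thesis
    by (simp add: l2c0_seqs_def)
qed

lemma l2c0_seqs_tailE:
  assumes "f \<in> l2c0_seqs" "e > 0"
  obtains F0 where "finite F0"
    "\<And>F t. finite F \<Longrightarrow> F \<inter> F0 = {} \<Longrightarrow> L2_set (\<lambda>j. cmod (f j t)) F \<le> e"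
proof -
  have "\<forall>e>0. \<exists>F0. finite F0 \<and>
      (\<forall>F t. finite F \<and> F \<inter> F0 = {} \<longrightarrow> L2_set (\<lambda>j. cmod (f j t)) F \<le> e)"
    using assms(1) unfolding l2c0_seqs_iff by (rule conjunct2)
  from mp[OF spec[OF this] assms(2)] obtain F0 where "finite F0 \<and>
      (\<forall>F t. finite F \<and> F \<inter> F0 = {} \<longrightarrow> L2_set (\<lambda>j. cmod (f j t)) F \<le> e)"
    by (rule exE)
  then show ?thesis
    by (intro that[of F0]) simp_all
qed

lemma L2_set_cmod_add_le:
  "L2_set (\<lambda>j. cmod (f j + g j)) F \<le> L2_set (\<lambda>j. cmod (f j)) F + L2_set (\<lambda>j. cmod (g j)) F"
  by (rule order_trans[OF L2_set_mono L2_set_triangle_ineq]) (auto intro: norm_triangle_ineq)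

lemma zero_l2c0_seqs: "(\<lambda>_. 0) \<in> l2c0_seqs"
  unfolding l2c0_seqs_iff by (auto simp: zero_c0fun L2_set_def)

lemma add_l2c0_seqs:
  assumes "f \<in> l2c0_seqs" "g \<in> l2c0_seqs"
  shows "(\<lambda>j. f j + g j) \<in> l2c0_seqs"
  unfolding l2c0_seqs_iff
proof (intro conjI allI impI)
  show "f j + g j \<in> c0fun" for j
    using assms by (auto simp: l2c0_seqs_def intro: add_c0fun)
  fix e :: real assume "e > 0"
  then have "e / 2 > 0" by simp
  obtain F0 where F0: "finite F0"
      "\<And>F t. finite F \<Longrightarrow> F \<inter> F0 = {} \<Longrightarrow> L2_set (\<lambda>j. cmod (f j t)) F \<le> e / 2"
    by (rule l2c0_seqs_tailE[OF assms(1) \<open>e / 2 > 0\<close>]) (rule that)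
  obtain G0 where G0: "finite G0"
      "\<And>F t. finite F \<Longrightarrow> F \<inter> G0 = {} \<Longrightarrow> L2_set (\<lambda>j. cmod (g j t)) F \<le> e / 2"
    by (rule l2c0_seqs_tailE[OF assms(2) \<open>e / 2 > 0\<close>]) (rule that)
  have "L2_set (\<lambda>j. cmod ((f j + g j) t)) F \<le> e" if "finite F" "F \<inter> (F0 \<union> G0) = {}" for F t
  proof -
    have "F \<inter> F0 = {}" "F \<inter> G0 = {}" using that by auto
    then show ?thesis
      using L2_set_cmod_add_le[of "\<lambda>j. f j t" "\<lambda>j. g j t" F]
        F0(2)[OF that(1), of t] G0(2)[OF that(1), of t] by simp
  qed
  with F0(1) G0(1) show "\<exists>F0. finite F0 \<and> (\<forall>F t. finite F \<and> F \<inter> F0 = {} \<longrightarrow>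
      L2_set (\<lambda>j. cmod ((f j + g j) t)) F \<le> e)"
    by (intro exI[of _ "F0 \<union> G0"]) blast
qed

lemma scaleR_l2c0_seqs:
  assumes "f \<in> l2c0_seqs"
  shows "(\<lambda>j. c *\<^sub>R f j) \<in> l2c0_seqs"
  unfolding l2c0_seqs_iff
proof (intro conjI allI impI)
  show "c *\<^sub>R f j \<in> c0fun" for j
    using assms by (auto simp: l2c0_seqs_def intro: scaleR_c0fun)
  fix e :: real assume "e > 0"
  then have "e / (\<bar>c\<bar> + 1) > 0" by simp
  then obtain F0 where F0: "finite F0"
      "\<And>F t. finite F \<Longrightarrow> F \<inter> F0 = {} \<Longrightarrow> L2_set (\<lambda>j. cmod (f j t)) F \<le> e / (\<bar>c\<bar> + 1)"
    by (rule l2c0_seqs_tailE[OF assms]) (rule that)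
  have "L2_set (\<lambda>j. cmod ((c *\<^sub>R f j) t)) F \<le> e" if "finite F" "F \<inter> F0 = {}" for F t
  proof -
    have "L2_set (\<lambda>j. cmod ((c *\<^sub>R f j) t)) F = \<bar>c\<bar> * L2_set (\<lambda>j. cmod (f j t)) F"
      by (simp add: L2_set_right_distrib)
    also have "\<dots> \<le> (\<bar>c\<bar> + 1) * (e / (\<bar>c\<bar> + 1))"
      using F0(2)[OF that] by (intro mult_mono) auto
    also have "\<dots> = e" by (simp add: field_simps)
    finally show ?thesis .
  qed
  with F0(1) show "\<exists>F0. finite F0 \<and> (\<forall>F t. finite F \<and> F \<inter> F0 = {} \<longrightarrow>
      L2_set (\<lambda>j. cmod ((c *\<^sub>R f j) t)) F \<le> e)"
    by blast
qed

typedef (overloaded) 'a l2c0 = "l2c0_seqs :: (int \<Rightarrow> 'a::topological_space \<Rightarrow>\<^sub>C complex) set"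
  morphisms l2c0_nth Abs_l2c0
  using zero_l2c0_seqs by blast

setup_lifting type_definition_l2c0

lemma l2c0_eqI: "(\<And>j t. l2c0_nth f j t = l2c0_nth g j t) \<Longrightarrow> f = g"
  by (metis bcontfun_eqI ext l2c0_nth_inject)

instantiation l2c0 :: (topological_space) real_vector
begin

lift_definition zero_l2c0 :: "'a l2c0" is "\<lambda>_. 0"
  by (rule zero_l2c0_seqs)
lift_definition plus_l2c0 :: "'a l2c0 \<Rightarrow> 'a l2c0 \<Rightarrow> 'a l2c0" is "\<lambda>f g j. f j + g j"
  by (rule add_l2c0_seqs)
lift_definition scaleR_l2c0 :: "real \<Rightarrow> 'a l2c0 \<Rightarrow> 'a l2c0" is "\<lambda>c f j. c *\<^sub>R f j"
  by (rule scaleR_l2c0_seqs)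
lift_definition uminus_l2c0 :: "'a l2c0 \<Rightarrow> 'a l2c0" is "\<lambda>f j. - f j"
  using scaleR_l2c0_seqs[of _ "-1"] by simp
lift_definition minus_l2c0 :: "'a l2c0 \<Rightarrow> 'a l2c0 \<Rightarrow> 'a l2c0" is "\<lambda>f g j. f j - g j"
  using add_l2c0_seqs[OF _ scaleR_l2c0_seqs[of _ "-1"]] by simp

instance
  by standard (transfer; simp add: algebra_simps)+

end

lemmas l2c0_nth_simps [simp] =
  zero_l2c0.rep_eq plus_l2c0.rep_eq scaleR_l2c0.rep_eq uminus_l2c0.rep_eq minus_l2c0.rep_eq

definition l2c0_norm :: "'a::topological_space l2c0 \<Rightarrow> real" where
  "l2c0_norm f = sqrt (norm (\<Sum>\<^sub>\<infinity>j. cmod_sq (l2c0_nth f j)))"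

lemma l2c0_norm_le_iff:
  "l2c0_norm f \<le> B \<longleftrightarrow> (\<forall>F t. finite F \<longrightarrow> L2_set (\<lambda>j. cmod (l2c0_nth f j t)) F \<le> B)"
proof -
  let ?S = "\<Sum>\<^sub>\<infinity>j. cmod_sq (l2c0_nth f j)"
  have "((\<lambda>j. cmod_sq (l2c0_nth f j)) has_sum ?S) UNIV"
    using l2c0_nth[of f] by (simp add: l2c0_seqs_def)
  then have lim: "(sum (\<lambda>j. cmod_sq (l2c0_nth f j)) \<longlongrightarrow> ?S) (finite_subsets_at_top UNIV)"
    by (simp add: has_sum_def)
  have hs: "((\<lambda>j. (cmod (l2c0_nth f j t))\<^sup>2) has_sum ?S t) UNIV" for t
    using tendsto_uniform_limitI[OF tendsto_bcontfun_uniform_limit[OF lim], of t]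
    by (simp add: has_sum_def apply_bcontfun_sum)
  have S0: "?S t \<ge> 0" for t
    using hs by (rule has_sum_nonneg) simp
  show ?thesis
  proof (cases "B \<ge> 0")
    case True
    have "l2c0_norm f \<le> B \<longleftrightarrow> norm ?S \<le> B\<^sup>2"
      unfolding l2c0_norm_def using True by (metis norm_ge_zero real_sqrt_le_iff real_sqrt_unique)
    also have "\<dots> \<longleftrightarrow> (\<forall>t. ?S t \<le> B\<^sup>2)"
    proof
      assume "norm ?S \<le> B\<^sup>2"
      then show "\<forall>t. ?S t \<le> B\<^sup>2"
        by (metis S0 abs_of_nonneg norm_bounded order_trans real_norm_def)
    next
      assume "\<forall>t. ?S t \<le> B\<^sup>2"
      then show "norm ?S \<le> B\<^sup>2" 
        by (intro norm_bound) (simp add: S0)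
    qed
    also have "\<dots> \<longleftrightarrow> (\<forall>F t. finite F \<longrightarrow> (\<Sum>j\<in>F. (cmod (l2c0_nth f j t))\<^sup>2) \<le> B\<^sup>2)"
    proof safe
      fix F :: "int set" and t assume "\<forall>t. ?S t \<le> B\<^sup>2" "finite F"
      then show "(\<Sum>j\<in>F. (cmod (l2c0_nth f j t))\<^sup>2) \<le> B\<^sup>2"
        using finite_sum_le_has_sum[OF hs, of F t] by (auto intro: order_trans)
    next
      fix t assume "\<forall>F t. finite F \<longrightarrow> (\<Sum>j\<in>F. (cmod (l2c0_nth f j t))\<^sup>2) \<le> B\<^sup>2"
      then show "?S t \<le> B\<^sup>2"
        by (intro has_sum_le_finite_sums[OF hs]) auto
    qed
    also have "\<dots> \<longleftrightarrow> (\<forall>F t. finite F \<longrightarrow> L2_set (\<lambda>j. cmod (l2c0_nth f j t)) F \<le> B)"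
      unfolding L2_set_def using True 
      by (metis (no_types, lifting) real_sqrt_le_iff real_sqrt_unique)
    finally show ?thesis .
  next
    case False
    have "l2c0_norm f \<ge> 0" by (simp add: l2c0_norm_def)
    moreover have "\<not> L2_set (\<lambda>j. cmod (l2c0_nth f j t)) {} \<le> B" for t
      using False by simp
    ultimately show ?thesis using False by (meson finite.emptyI order_trans)
  qed
qed

lemma L2_set_le_l2c0_norm:
  "finite F \<Longrightarrow> L2_set (\<lambda>j. cmod (l2c0_nth f j t)) F \<le> l2c0_norm f"
  using l2c0_norm_le_iff[of f "l2c0_norm f"] by simp

lemma cmod_le_l2c0_norm: "cmod (l2c0_nth f j t) \<le> l2c0_norm f"
  using L2_set_le_l2c0_norm[of "{j}" f t] by simp

instantiation l2c0 :: (topological_space) real_normed_vector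
begin

definition norm_l2c0 :: "'a l2c0 \<Rightarrow> real" where
  "norm_l2c0 f = sqrt (norm (\<Sum>\<^sub>\<infinity>j. cmod_sq (l2c0_nth f j)))"
definition dist_l2c0 :: "'a l2c0 \<Rightarrow> 'a l2c0 \<Rightarrow> real" where
  "dist_l2c0 f g = norm (f - g)"
definition sgn_l2c0 :: "'a l2c0 \<Rightarrow> 'a l2c0" where
  "sgn_l2c0 f = f /\<^sub>R norm f"
definition uniformity_l2c0 :: "('a l2c0 \<times> 'a l2c0) filter" where
  "uniformity_l2c0 = (INF e\<in>{0<..}. principal {(x, y). dist x y < e})"
definition open_l2c0 :: "'a l2c0 set \<Rightarrow> bool" where
  "open_l2c0 S = (\<forall>x\<in>S. \<forall>\<^sub>F (x', y) in uniformity. x' = x \<longrightarrow> y \<in> S)"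

instance
proof
  fix f g :: "'a l2c0" and c :: real
  have [simp]: "norm h = l2c0_norm h" for h :: "'a l2c0"
    by (simp add: norm_l2c0_def l2c0_norm_def)
  show "(norm f = 0) \<longleftrightarrow> (f = 0)"
  proof
    assume "norm f = 0"
    then have "cmod (l2c0_nth f j t) \<le> 0" for j t
      using cmod_le_l2c0_norm[of f j t] by simp
    then show "f = 0"
      by (intro l2c0_eqI) simp
  next
    assume "f = 0"
    then have "l2c0_norm f \<le> 0"
      by (simp add: l2c0_norm_le_iff L2_set_def)
    then show "norm f = 0"
      by (simp add: l2c0_norm_def antisym)
  qed
  show "norm (f + g) \<le> norm f + norm g"
    using L2_set_le_l2c0_norm[of _ f] L2_set_le_l2c0_norm[of _ g]
    by (auto simp: l2c0_norm_le_iff intro!: order_trans[OF L2_set_cmod_add_le] add_mono)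
  have le: "l2c0_norm (c *\<^sub>R f) \<le> \<bar>c\<bar> * l2c0_norm f" for c and f :: "'a l2c0"
    using L2_set_le_l2c0_norm[of _ f]
    by (auto simp: l2c0_norm_le_iff L2_set_right_distrib[symmetric] intro!: mult_left_mono)
  show "norm (c *\<^sub>R f) = \<bar>c\<bar> * norm f"
  proof (cases "c = 0")
    case True
    then show ?thesis using le[of 0 f] by (simp add: l2c0_norm_def antisym)
  next
    case False
    then have "\<bar>c\<bar> * l2c0_norm f \<le> l2c0_norm (c *\<^sub>R f)"
      using le[of "inverse c" "c *\<^sub>R f"] by (simp add: field_simps)
    with le[of c f] show ?thesis by simp
  qed
qed (auto simp: dist_l2c0_def sgn_l2c0_def uniformity_l2c0_def open_l2c0_def)

end

lemma norm_l2c0_le_iff: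
  "norm f \<le> B \<longleftrightarrow> (\<forall>F t. finite F \<longrightarrow> L2_set (\<lambda>j. cmod (l2c0_nth f j t)) F \<le> B)"
  for f :: "'a::topological_space l2c0"
  using l2c0_norm_le_iff[of f B] by (simp add: norm_l2c0_def l2c0_norm_def)

lemma L2_set_le_norm_l2c0:
  "finite F \<Longrightarrow> L2_set (\<lambda>j. cmod (l2c0_nth f j t)) F \<le> norm f"
  using norm_l2c0_le_iff[of f "norm f"] by simp

lemma cmod_le_norm_l2c0: "cmod (l2c0_nth f j t) \<le> norm f"
  using L2_set_le_norm_l2c0[of "{j}" f t] by simp

instance l2c0 :: (topological_space) banach
proof
  fix X :: "nat \<Rightarrow> 'a l2c0"
  assume X: "Cauchy X"
  have "\<exists>y. (\<lambda>n. l2c0_nth (X n) j) \<longlonglongrightarrow> y" for j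
  proof -
    have "\<exists>l. uniform_limit UNIV (\<lambda>n. apply_bcontfun (l2c0_nth (X n) j)) l sequentially"
    proof -
      have "\<exists>N. \<forall>m n t. N \<le> m \<and> N \<le> n \<longrightarrow>
          dist (l2c0_nth (X m) j t) (l2c0_nth (X n) j t) < e" if e: "e > 0" for e
      proof -
        obtain N where N: "\<And>m n. m \<ge> N \<Longrightarrow> n \<ge> N \<Longrightarrow> norm (X m - X n) < e"
          using CauchyD[OF X e] by blast
        have "dist (l2c0_nth (X m) j t) (l2c0_nth (X n) j t) < e" if "m \<ge> N" "n \<ge> N" for m n t
          using cmod_le_norm_l2c0[of "X m - X n" j t] N[OF that] by (simp add: dist_norm)
        then show ?thesis
          by blast
      qed
      then show ?thesis
        using uniformly_convergent_eq_cauchy[of "\<lambda>_. True" "\<lambda>n. apply_bcontfun (l2c0_nth (X n) j)"]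
        unfolding uniform_limit_sequentially_iff by auto
    qed
    then show ?thesis
      by (metis uniform_limit_bcontfunE sequentially_bot)
  qed
  then obtain Y where Y: "\<And>j. (\<lambda>n. l2c0_nth (X n) j) \<longlonglongrightarrow> Y j" by metis
  have Yt: "(\<lambda>n. l2c0_nth (X n) j t) \<longlonglongrightarrow> Y j t" for j t
    using tendsto_uniform_limitI[OF tendsto_bcontfun_uniform_limit[OF Y]] by simp
  have close: "\<exists>N. \<forall>m\<ge>N. \<forall>F t. finite F \<longrightarrow>
      L2_set (\<lambda>j. cmod (l2c0_nth (X m) j t - Y j t)) F \<le> e" if e: "e > 0" for e
  proof -
    obtain N where N: "\<And>m n. m \<ge> N \<Longrightarrow> n \<ge> N \<Longrightarrow> norm (X m - X n) < e"
      using CauchyD[OF X e] by blast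
    have "L2_set (\<lambda>j. cmod (l2c0_nth (X m) j t - Y j t)) F \<le> e" if "m \<ge> N" "finite F" for m F t
    proof (rule tendsto_upperbound)
      show "(\<lambda>n. L2_set (\<lambda>j. cmod (l2c0_nth (X m) j t - l2c0_nth (X n) j t)) F)
          \<longlonglongrightarrow> L2_set (\<lambda>j. cmod (l2c0_nth (X m) j t - Y j t)) F"
        unfolding L2_set_def by (intro tendsto_intros Yt)
      show "\<forall>\<^sub>F n in sequentially.
          L2_set (\<lambda>j. cmod (l2c0_nth (X m) j t - l2c0_nth (X n) j t)) F \<le> e"
        using eventually_ge_at_top[of N]
      proof eventually_elim
        case (elim n)
        show ?case
          using L2_set_le_norm_l2c0[OF \<open>finite F\<close>, of "X m - X n" t] N[OF \<open>m \<ge> N\<close> elim] by simp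
      qed
    qed simp
    then show ?thesis by blast
  qed
  have "Y \<in> l2c0_seqs"
    unfolding l2c0_seqs_iff
  proof (intro conjI allI impI)
    fix j show "Y j \<in> c0fun"
      unfolding c0fun_def
    proof safe
      fix e :: real assume "e > 0"
      then have e: "e / 2 > 0" by simp
      then obtain N where N: "\<And>F t. finite F \<Longrightarrow>
          L2_set (\<lambda>j. cmod (l2c0_nth (X N) j t - Y j t)) F \<le> e / 2"
        using close by blast
      have "l2c0_nth (X N) j \<in> c0fun"
        using l2c0_nth[of "X N"] by (simp add: l2c0_seqs_def)
      then obtain K where K: "compact K" "\<And>t. t \<notin> K \<Longrightarrow> cmod (l2c0_nth (X N) j t) < e / 2"
        using e unfolding c0fun_def by blast
      have "cmod (Y j t) < e" if "t \<notin> K" for t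
        using N[of "{j}" t] K(2)[OF that] norm_triangle_sub[of "Y j t" "l2c0_nth (X N) j t"]
        by (simp add: norm_minus_commute)
      with K show "\<exists>K. compact K \<and> (\<forall>t. t \<notin> K \<longrightarrow> cmod (Y j t) < e)" by blast
    qed
  next
    fix e :: real assume "e > 0"
    then have e: "e / 2 > 0" by simp
    then obtain N where N: "\<And>F t. finite F \<Longrightarrow>
        L2_set (\<lambda>j. cmod (l2c0_nth (X N) j t - Y j t)) F \<le> e / 2"
      using close by blast
    obtain F0 where F0: "finite F0" "\<And>F t. finite F \<Longrightarrow> F \<inter> F0 = {} \<Longrightarrow>
        L2_set (\<lambda>j. cmod (l2c0_nth (X N) j t)) F \<le> e / 2"
      by (rule l2c0_seqs_tailE[OF l2c0_nth[of "X N"] e]) (rule that)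
    have "L2_set (\<lambda>j. cmod (Y j t)) F \<le> e" if F: "finite F" "F \<inter> F0 = {}" for F t
      using L2_set_cmod_add_le[of "\<lambda>j. Y j t - l2c0_nth (X N) j t" "\<lambda>j. l2c0_nth (X N) j t" F]
        N[OF F(1), of t] F0(2)[OF F, of t]
      by (simp add: norm_minus_commute)
    with F0(1) show "\<exists>F0. finite F0 \<and> (\<forall>F t. finite F \<and> F \<inter> F0 = {} \<longrightarrow>
        L2_set (\<lambda>j. cmod (Y j t)) F \<le> e)" by blast
  qed
  then have nY: "l2c0_nth (Abs_l2c0 Y) = Y" by (rule Abs_l2c0_inverse)
  have "X \<longlonglongrightarrow> Abs_l2c0 Y"
  proof (rule LIMSEQ_I)
    fix e :: real assume "e > 0"
    then have e: "e / 2 > 0" by simp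
    from close[OF e] obtain N where N: "\<And>m F t. m \<ge> N \<Longrightarrow> finite F \<Longrightarrow>
        L2_set (\<lambda>j. cmod (l2c0_nth (X m) j t - Y j t)) F \<le> e / 2"
      by blast
    have "norm (X m - Abs_l2c0 Y) < e" if "m \<ge> N" for m
    proof -
      have "norm (X m - Abs_l2c0 Y) \<le> e / 2"
        unfolding norm_l2c0_le_iff using N[OF that] by (simp add: nY)
      with \<open>e > 0\<close> show ?thesis by simp
    qed
    then show "\<exists>N. \<forall>m\<ge>N. norm (X m - Abs_l2c0 Y) < e" by blast
  qed
  then show "convergent X" by (rule convergentI)
qed

section \<open>Weighted shifts\<close>

text \<open>
  The step width \<open>R\<close> stands for the product of \<open>r\<^sub>\<ell>\<close> and \<open>n\<close>. The weight is indexed here by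
  the target index, i.e. \<open>m = j + R\<close> in \<open>(b)\<^bsub>j+R\<^esub> = (\<Prod>k=1..R. w\<^bsub>j+k\<^esub> \<circ> \<alpha>\<^bsup>R-k\<^esup>)\<close>.
\<close>

definition shift_comp ::
  "('a \<Rightarrow> 'a) \<Rightarrow> nat \<Rightarrow> (int \<Rightarrow> 'a \<Rightarrow> complex) \<Rightarrow> int \<Rightarrow> 'a \<Rightarrow> complex" where
  "shift_comp \<alpha> R f j = f (j - int R) \<circ> (\<alpha> ^^ R)"

definition shift_weight ::
  "('a \<Rightarrow> 'a) \<Rightarrow> (int \<Rightarrow> 'a::topological_space \<Rightarrow>\<^sub>C real) \<Rightarrow> nat \<Rightarrow> int \<Rightarrow> 'a \<Rightarrow> real" where
  "shift_weight \<alpha> w R m t = (\<Prod>k=1..R. w (m - int R + int k) ((\<alpha> ^^ (R - k)) t))"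

text \<open>
  The arguments of \<open>Bcontfun\<close>, \<open>Abs_l2c0\<close> and \<open>Blinfun\<close> lie in the respective domains whenever
  \<open>\<alpha>\<close> is a homeomorphism and the weights are uniformly bounded; see \<open>weighted_shift_apply\<close> below.
\<close>

definition weighted_shift ::
  "('a \<Rightarrow> 'a) \<Rightarrow> (int \<Rightarrow> 'a::topological_space \<Rightarrow>\<^sub>C real) \<Rightarrow> nat \<Rightarrow> 'a l2c0 \<Rightarrow>\<^sub>L 'a l2c0" where
  "weighted_shift \<alpha> w R = Blinfun (\<lambda>a. Abs_l2c0 (\<lambda>j. Bcontfun (\<lambda>t.
     of_real (shift_weight \<alpha> w R j t) * shift_comp \<alpha> R (\<lambda>i. apply_bcontfun (l2c0_nth a i)) j t)))"

lemma weighted_shift_apply: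
  fixes \<alpha> :: "'a::topological_space \<Rightarrow> 'a" and w :: "int \<Rightarrow> 'a \<Rightarrow>\<^sub>C real"
  assumes hom: "homeomorphic_map euclidean euclidean \<alpha>" and M: "\<And>j. norm (w j) \<le> M"
  shows "l2c0_nth (weighted_shift \<alpha> w R a) j t =
     of_real (\<Prod>k=1..R. w (j - int R + int k) ((\<alpha> ^^ (R - k)) t)) *
     l2c0_nth a (j - int R) ((\<alpha> ^^ R) t)"
proof -
  let ?b = "shift_weight \<alpha> w R"
  let ?h = "\<lambda>a j t. of_real (?b j t) * l2c0_nth a (j - int R) ((\<alpha> ^^ R) t)"
  have M0: "M \<ge> 0" using M[of 0] norm_ge_zero order_trans by blast
  obtain \<beta> where \<beta>: "continuous_on UNIV \<beta>" "\<And>x. \<beta> (\<alpha> x) = x" "\<And>x. \<alpha> (\<beta> x) = x"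
    using hom by (auto simp: homeomorphic_map_maps homeomorphic_maps_def)
  have c\<alpha>: "continuous_on UNIV \<alpha>"
    using hom by (auto simp: homeomorphic_map_maps homeomorphic_maps_def)
  have pow: "continuous_on UNIV (f ^^ m)" if "continuous_on UNIV f" for f :: "'a \<Rightarrow> 'a" and m
  proof (induction m)
    case (Suc m)
    then show ?case
      using continuous_on_compose2[OF that, of UNIV "f ^^ m"] by (simp add: comp_def)
  qed (simp add: id_def)
  have inv1: "(\<beta> ^^ m) ((\<alpha> ^^ m) x) = x" for m x
  proof (induction m arbitrary: x)
    case (Suc m)
    then show ?case by (simp add: funpow_swap1[of \<beta>] \<beta>)
  qed simp
  have b_le: "\<bar>?b j t\<bar> \<le> M ^ R" for j t
  proof -
    have "\<bar>?b j t\<bar> = (\<Prod>k=1..R. \<bar>w (j - int R + int k) ((\<alpha> ^^ (R - k)) t)\<bar>)"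
      by (simp add: shift_weight_def abs_prod)
    also have "\<dots> \<le> (\<Prod>k=1..R. M)"
    proof (intro prod_mono conjI)
      show "\<bar>w (j - int R + int k) ((\<alpha> ^^ (R - k)) t)\<bar> \<le> M" for k
        using norm_bounded[of "w (j - int R + int k)"] M
        by (metis order_trans real_norm_def)
    qed simp
    finally show ?thesis by simp
  qed
  have cont_w: "continuous_on UNIV (\<lambda>t. w i ((\<alpha> ^^ m) t))" for i m
    by (rule continuous_on_compose2[OF continuous_on_apply_bcontfun[of UNIV] pow[OF c\<alpha>]]) simp
  have cont_b: "continuous_on UNIV (?b j)" for j
    unfolding shift_weight_def by (intro continuous_on_prod cont_w)
  have cont_a: "continuous_on UNIV (\<lambda>t. l2c0_nth a i ((\<alpha> ^^ m) t))" for a :: "'a l2c0" and i m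
    by (rule continuous_on_compose2[OF continuous_on_apply_bcontfun[of UNIV] pow[OF c\<alpha>]]) simp
  have h_le: "cmod (?h a j t) \<le> M ^ R * cmod (l2c0_nth a (j - int R) ((\<alpha> ^^ R) t))" for a j t
    using b_le[of j t] by (simp add: norm_mult mult_right_mono)
  have h_bc: "?h a j \<in> bcontfun" for a j
  proof (rule bcontfun_normI)
    show "continuous_on UNIV (?h a j)"
      by (intro continuous_intros cont_b cont_a)
    show "norm (?h a j t) \<le> M ^ R * norm a" for t
    proof -
      have "M ^ R * cmod (l2c0_nth a (j - int R) ((\<alpha> ^^ R) t)) \<le> M ^ R * norm a"
        using M0 by (intro mult_left_mono cmod_le_norm_l2c0) simp
      with h_le[of j t a] show ?thesis by linarith
    qed
  qed
  have ap: "apply_bcontfun (Bcontfun (?h a j)) = ?h a j" for a j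
    by (rule Bcontfun_inverse[OF h_bc])
  have L2: "L2_set (\<lambda>j. cmod (?h a j t)) F \<le>
      M ^ R * L2_set (\<lambda>j. cmod (l2c0_nth a j ((\<alpha> ^^ R) t))) ((\<lambda>j. j - int R) ` F)" for a F t
  proof -
    have "L2_set (\<lambda>j. cmod (?h a j t)) F
        \<le> L2_set (\<lambda>j. M ^ R * cmod (l2c0_nth a (j - int R) ((\<alpha> ^^ R) t))) F"
      by (intro L2_set_mono h_le) auto
    also have "\<dots> = M ^ R * L2_set (\<lambda>j. cmod (l2c0_nth a (j - int R) ((\<alpha> ^^ R) t))) F"
      using M0 by (simp add: L2_set_right_distrib)
    also have "L2_set (\<lambda>j. cmod (l2c0_nth a (j - int R) ((\<alpha> ^^ R) t))) F
        = L2_set (\<lambda>j. cmod (l2c0_nth a j ((\<alpha> ^^ R) t))) ((\<lambda>j. j - int R) ` F)"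
      unfolding L2_set_def by (subst sum.reindex) (auto simp: inj_on_def)
    finally show ?thesis .
  qed
  have mem: "(\<lambda>j. Bcontfun (?h a j)) \<in> l2c0_seqs" for a
    unfolding l2c0_seqs_iff
  proof (intro conjI allI impI)
    fix j
    show "Bcontfun (?h a j) \<in> c0fun"
      unfolding c0fun_def mem_Collect_eq ap
    proof safe
      fix e :: real assume e: "e > 0"
      have "M ^ R + 1 > 0" using M0 by (simp add: add_nonneg_pos)
      with e have "e / (M ^ R + 1) > 0" by simp
      moreover have "l2c0_nth a (j - int R) \<in> c0fun"
        using l2c0_nth[of a] by (simp add: l2c0_seqs_def)
      ultimately obtain K where K: "compact K"
          "\<And>t. t \<notin> K \<Longrightarrow> cmod (l2c0_nth a (j - int R) t) < e / (M ^ R + 1)"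
        unfolding c0fun_def by blast
      have "compact ((\<beta> ^^ R) ` K)"
        using pow[OF \<beta>(1)] K(1) by (intro compact_continuous_image) (auto intro: continuous_on_subset)
      moreover have "cmod (?h a j t) < e" if "t \<notin> (\<beta> ^^ R) ` K" for t
      proof -
        have "(\<alpha> ^^ R) t \<notin> K"
          using that inv1[of R t] by (metis imageI)
        then have "cmod (l2c0_nth a (j - int R) ((\<alpha> ^^ R) t)) * (M ^ R + 1) < e"
          using K(2) \<open>M ^ R + 1 > 0\<close> by (simp add: pos_less_divide_eq)
        moreover have "M ^ R * cmod (l2c0_nth a (j - int R) ((\<alpha> ^^ R) t)) \<le>
            cmod (l2c0_nth a (j - int R) ((\<alpha> ^^ R) t)) * (M ^ R + 1)"
          by (simp add: algebra_simps)
        ultimately show ?thesis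
          using h_le[of j t a] by linarith
      qed
      ultimately show "\<exists>K. compact K \<and> (\<forall>t. t \<notin> K \<longrightarrow> cmod (?h a j t) < e)" by blast
    qed
  next
    fix e :: real assume e: "e > 0"
    have p: "M ^ R + 1 > 0" using M0 by (simp add: add_nonneg_pos)
    with e have "e / (M ^ R + 1) > 0" by simp
    then obtain F0 where F0: "finite F0" "\<And>F t. finite F \<Longrightarrow> F \<inter> F0 = {} \<Longrightarrow>
        L2_set (\<lambda>j. cmod (l2c0_nth a j t)) F \<le> e / (M ^ R + 1)"
      by (rule l2c0_seqs_tailE[OF l2c0_nth[of a]]) (rule that)
    have "L2_set (\<lambda>j. cmod (Bcontfun (?h a j) t)) F \<le> e"
      if F: "finite F" "F \<inter> (\<lambda>j. j + int R) ` F0 = {}" for F t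
    proof -
      have "(\<lambda>j. j - int R) ` F \<inter> F0 = {}"
      proof (rule ccontr)
        assume "(\<lambda>j. j - int R) ` F \<inter> F0 \<noteq> {}"
        then obtain j where "j \<in> F" "j - int R \<in> F0" by auto
        then have "j \<in> F \<inter> (\<lambda>j. j + int R) ` F0" by force
        with F show False by blast
      qed
      then have "L2_set (\<lambda>j. cmod (l2c0_nth a j ((\<alpha> ^^ R) t))) ((\<lambda>j. j - int R) ` F)
          \<le> e / (M ^ R + 1)"
        using F by (intro F0(2)) auto
      then have "M ^ R * L2_set (\<lambda>j. cmod (l2c0_nth a j ((\<alpha> ^^ R) t))) ((\<lambda>j. j - int R) ` F)
          \<le> (M ^ R + 1) * (e / (M ^ R + 1))"
        using M0 by (intro mult_mono) auto
      also have "\<dots> = e" using p by simp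
      finally show ?thesis
        unfolding ap using L2[where a = a and t = t and F = F] by linarith
    qed
    then show "\<exists>F0. finite F0 \<and> (\<forall>F t. finite F \<and> F \<inter> F0 = {} \<longrightarrow>
        L2_set (\<lambda>j. cmod (Bcontfun (?h a j) t)) F \<le> e)"
      using F0(1) by (intro exI[of _ "(\<lambda>j. j + int R) ` F0"]) blast
  qed
  let ?T = "\<lambda>a. Abs_l2c0 (\<lambda>j. Bcontfun (?h a j))"
  have nth: "apply_bcontfun (l2c0_nth (?T a) j) = ?h a j" for a j
    by (simp add: Abs_l2c0_inverse[OF mem] ap)
  have "bounded_linear ?T"
  proof (rule bounded_linear_intro)
    show "?T (a + b) = ?T a + ?T b" for a b
      by (rule l2c0_eqI, subst nth) (simp only: l2c0_nth_simps plus_bcontfun.rep_eq nth distrib_left)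
    show "?T (c *\<^sub>R a) = c *\<^sub>R ?T a" for c a
      by (rule l2c0_eqI, subst nth) (simp only: l2c0_nth_simps scaleR_bcontfun.rep_eq nth mult_scaleR_right)
    show "norm (?T a) \<le> norm a * M ^ R" for a
      unfolding norm_l2c0_le_iff nth
    proof (intro allI impI)
      fix F :: "int set" and t assume "finite F"
      then have "L2_set (\<lambda>j. cmod (l2c0_nth a j ((\<alpha> ^^ R) t))) ((\<lambda>j. j - int R) ` F) \<le> norm a"
        by (intro L2_set_le_norm_l2c0) simp
      then have "M ^ R * L2_set (\<lambda>j. cmod (l2c0_nth a j ((\<alpha> ^^ R) t))) ((\<lambda>j. j - int R) ` F)
          \<le> M ^ R * norm a"
        using M0 by (intro mult_left_mono) auto
      with L2[where a = a and t = t and F = F] show "L2_set (\<lambda>j. cmod (?h a j t)) F \<le> norm a * M ^ R"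
        by (simp add: mult.commute)
    qed
  qed
  then have "blinfun_apply (weighted_shift \<alpha> w R) = ?T"
    unfolding weighted_shift_def shift_comp_def comp_def by (rule bounded_linear_Blinfun_apply)
  then have "l2c0_nth (weighted_shift \<alpha> w R a) j t = ?h a j t"
    by (simp only: nth)
  then show ?thesis
    unfolding shift_weight_def .
qed

section \<open>Disjoint semi-transitivity\<close>

definition d_semi_transitive ::
  "nat set set \<Rightarrow> nat \<Rightarrow> (nat \<Rightarrow> nat \<Rightarrow> 'x::banach \<Rightarrow>\<^sub>L 'x) \<Rightarrow> bool" where
  "d_semi_transitive \<F> N T \<longleftrightarrow>
    (\<forall>\<O> V. open \<O> \<and> \<O> \<noteq> {} \<and> (\<forall>l\<in>{1..N}. open (V l) \<and> V l \<noteq> {}) \<longrightarrow>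
      (\<exists>F\<in>\<F>. \<forall>n\<in>F. \<exists>c>0.
        \<O> \<inter> (\<Inter>l\<in>{1..N}. (\<lambda>x. c *\<^sub>R x) ` (blinfun_apply (T n l) -` V l)) \<noteq> {}))"

text \<open>
  Natural numbers start at 1 here, so that the operator families are indexed by positive integers.
\<close>

definition infinite_subsets :: "nat set set" where
  "infinite_subsets = {F. F \<subseteq> {1..} \<and> infinite F}"

text \<open>
  Supremum of a non-negative function, for which the supremum over the empty set is 0
  (the real \<open>Sup {}\<close> is unspecified).
\<close>

definition sup_over :: "'a set \<Rightarrow> ('a \<Rightarrow> real) \<Rightarrow> real" where
  "sup_over K f = (if K = {} then 0 else (SUP t\<in>K. f t))"

end

theory Submission
  imports Defs
begin

text \<open>
  Write \<open>T\<^sub>l\<close> for the \<open>n\<close>-th operator of the \<open>l\<close>-th family and \<open>R\<^sub>l = r\<^sub>l n\<close>. A value of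
  \<open>T\<^sub>l a\<close> is one value of \<open>a\<close> times a weight: with \<open>B\<^sub>l\<close> = \<^const>\<open>shift_weight\<close>,
  it is \<open>(T\<^sub>l a)\<^sub>j (t) = B\<^sub>l (j, t) a\<^bsub>j-R\<^esub> (\<alpha>\<^sub>l\<^bsup>R\<^esup> t)\<close>, and read from the source,
  \<open>a\<^sub>j (t)\<close> is multiplied by \<open>D\<^sub>l (j, t)\<close>, the \<open>forward_weight\<close> below. So \<open>T\<^sub>s\<close> has a right inverse
  \<open>S\<^sub>s\<close> that divides by \<open>B\<^sub>s\<close>, and \<open>T\<^sub>l S\<^sub>s\<close> multiplies by the \<open>cross_weight\<close>. The two limits in
  the theorem say that, along a subsequence, the norm of \<open>S\<^sub>s\<close> times the norm of \<open>T\<^sub>l\<close> and the norm of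
  \<open>T\<^sub>l S\<^sub>s\<close> for \<open>s \<noteq> l\<close> tend to \<open>0\<close> on sequences supported in \<open>{j} \<times> K\<close>, for every \<open>j \<in> {-J..J}\<close>.

  Necessity (\<open>weights_small_if_semi_transitive\<close>): all open sets are taken to be one small ball around
  a sequence \<open>f\<close> that is \<open>1\<close> on \<open>{-J..J} \<times> K\<close> and \<open>0\<close> at all other indices. If \<open>x = c y\<close> and all the
  \<open>T\<^sub>l y\<close> lie in this ball and \<open>n > 2 J\<close>, the shifts by \<open>R\<^sub>l\<close> and by \<open>R\<^sub>l - R\<^sub>s\<close> move the block \<open>{-J..J}\<close>
  off itself. Off the block \<open>x\<close> and \<open>T\<^sub>l y\<close> are small, while over \<open>K\<close> on the block they are near \<open>1\<close>;
  comparing values that correspond to each other under the shifts bounds \<open>c / B\<^sub>s\<close>, \<open>D\<^sub>l / c\<close> and the cross weights.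

  Sufficiency (\<open>semi_transitive_if_weights_small\<close>): sequences with finite index support and compact
  support in \<open>t\<close> are dense, so it is enough to approximate such \<open>f\<close> and \<open>g\<^sub>l\<close>. The vector
  \<open>x = f + c (\<Sum>s. S\<^sub>s g\<^sub>s)\<close> satisfies \<open>T\<^sub>l (x / c) - g\<^sub>l = T\<^sub>l f / c + (\<Sum>s\<noteq>l. T\<^sub>l S\<^sub>s g\<^sub>s)\<close>, and \<open>c\<close> has to
  balance \<open>c S\<^sub>s\<close> against \<open>T\<^sub>l / c\<close>. Such a \<open>c\<close> exists if all products \<open>\<parallel>S\<^sub>s\<parallel> \<parallel>T\<^sub>l\<parallel>\<close> are small
  (\<open>ex_balancing_scalar\<close>). The hypothesis controls only the products in which both factors belong to the same
  index \<open>j\<close>, whereas \<open>f\<close> and \<open>g\<^sub>s\<close> may live at different indices. The gap is closed by moving along the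
  diagonals \<open>(j + m, t) \<mapsto> (j, \<alpha>\<^bsup>m\<^esup> t)\<close>: up to a constant independent of \<open>n\<close>, both \<open>1 / B\<close> and \<open>D\<close> at
  \<open>(j, t)\<close> are at most their values at \<open>(-J, \<alpha>\<^bsup>j+J\<^esup> t)\<close> (\<open>weights_along_diagonal\<close>), so it suffices to use the
  hypothesis at the single index \<open>-J\<close> for the larger compact set that contains \<open>\<alpha>\<^sub>s\<^bsup>m\<^esup> K\<close> for all
  \<open>s\<close> and all \<open>m \<le> 2 J\<close>.
\<close>

section \<open>Elements of the Hilbert module with finite support\<close>

definition supported_in :: "nat \<Rightarrow> 'a set \<Rightarrow> 'a::topological_space l2c0 \<Rightarrow> bool" where
  "supported_in J K x \<longleftrightarrow>
    (\<forall>j t. j \<notin> {- int J..int J} \<or> t \<notin> K \<longrightarrow> l2c0_nth x j t = 0)"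

lemma supported_in_mono:
  "supported_in J K x \<Longrightarrow> J \<le> J' \<Longrightarrow> K \<subseteq> K' \<Longrightarrow> supported_in J' K' x"
  unfolding supported_in_def by (metis atLeastAtMost_iff neg_le_iff_le of_nat_mono order_trans subsetD)

text \<open>
  A continuous function with compact support is bounded and vanishes at infinity, and finitely many
  entries leave no tail to be summed; this is how all explicit vectors below are built.
\<close>

lemma ex_l2c0_nth:
  fixes F :: "int \<Rightarrow> 'a::topological_space \<Rightarrow> complex"
  assumes "finite I" and K: "compact K"
    and cont: "\<And>j. continuous_on UNIV (F j)"
    and zero: "\<And>j t. j \<notin> I \<or> t \<notin> K \<Longrightarrow> F j t = 0"
  shows "\<exists>x. \<forall>j t. l2c0_nth x j t = F j t"
proof -
  have bc: "F j \<in> bcontfun" for j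
  proof -
    have "compact (F j ` K)"
      using K cont by (intro compact_continuous_image) (auto intro: continuous_on_subset)
    then obtain b where b: "\<And>t. t \<in> K \<Longrightarrow> cmod (F j t) \<le> b"
      by (meson bounded_iff compact_imp_bounded imageI)
    have "cmod (F j t) \<le> max 0 b" for t
      using b[of t] zero[of j t] by (cases "t \<in> K") auto
    then show ?thesis
      by (intro bcontfun_normI cont)
  qed
  have ap: "apply_bcontfun (Bcontfun (F j)) = F j" for j
    by (rule Bcontfun_inverse[OF bc])
  have "(\<lambda>j. Bcontfun (F j)) \<in> l2c0_seqs"
    unfolding l2c0_seqs_iff
  proof (intro conjI allI impI)
    show "Bcontfun (F j) \<in> c0fun" for j
      unfolding c0fun_def using K zero by (auto simp: ap intro!: exI[of _ K])
    fix e :: real assume "e > 0"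
    then show "\<exists>F0. finite F0 \<and> (\<forall>G t. finite G \<and> G \<inter> F0 = {} \<longrightarrow>
        L2_set (\<lambda>j. cmod (Bcontfun (F j) t)) G \<le> e)"
    proof (intro exI[of _ I] conjI allI impI \<open>finite I\<close>)
      fix G t assume "finite G \<and> G \<inter> I = {}"
      then have "\<forall>j\<in>G. cmod (F j t) = 0"
        using zero by auto
      then have "L2_set (\<lambda>j. cmod (F j t)) G = 0"
        by (rule L2_set_0')
      with \<open>e > 0\<close> show "L2_set (\<lambda>j. cmod (Bcontfun (F j) t)) G \<le> e"
        by (simp add: ap)
    qed
  qed
  then show ?thesis
    by (intro exI[of _ "Abs_l2c0 (\<lambda>j. Bcontfun (F j))"]) (simp add: Abs_l2c0_inverse ap)
qed

lemma norm_l2c0_le_card: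
  assumes "finite I" "\<And>j t. j \<notin> I \<Longrightarrow> l2c0_nth x j t = 0"
    and "\<And>j t. j \<in> I \<Longrightarrow> cmod (l2c0_nth x j t) \<le> b"
  shows "norm x \<le> real (card I) * b"
  unfolding norm_l2c0_le_iff
proof (intro allI impI)
  fix F :: "int set" and t assume "finite F"
  have "L2_set (\<lambda>j. cmod (l2c0_nth x j t)) F \<le> (\<Sum>j\<in>F. cmod (l2c0_nth x j t))"
    by (rule L2_set_le_sum) simp
  also have "\<dots> = (\<Sum>j\<in>F \<inter> I. cmod (l2c0_nth x j t))"
    using assms(2) \<open>finite F\<close> by (intro sum.mono_neutral_right) auto
  also have "\<dots> \<le> (\<Sum>j\<in>I. cmod (l2c0_nth x j t))"
    using assms(1) by (intro sum_mono2) auto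
  also have "\<dots> \<le> real (card I) * b"
    using assms(3) by (intro sum_bounded_above) auto
  finally show "L2_set (\<lambda>j. cmod (l2c0_nth x j t)) F \<le> real (card I) * b" .
qed

text \<open>
  The norm is evaluated in the coordinates \<open>(j + p, \<sigma> t)\<close>. For images and preimages under weighted shifts
  these are the coordinates in which the support is the original box \<open>{-J..J} \<times> K\<close>.
\<close>

lemma norm_l2c0_le_reindexed:
  assumes "surj \<sigma>" and "0 \<le> b"
    and "\<And>j t. j \<notin> {- int J..int J} \<or> t \<notin> K \<Longrightarrow> l2c0_nth x (j + p) (\<sigma> t) = 0"
    and "\<And>j t. j \<in> {- int J..int J} \<Longrightarrow> t \<in> K \<Longrightarrow> cmod (l2c0_nth x (j + p) (\<sigma> t)) \<le> b"
  shows "norm x \<le> (2 * real J + 1) * b"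
proof -
  have "norm x \<le> real (card {p - int J..p + int J}) * b"
  proof (rule norm_l2c0_le_card)
    fix j t
    obtain s where s: "t = \<sigma> s" using \<open>surj \<sigma>\<close> by blast
    show "l2c0_nth x j t = 0" if "j \<notin> {p - int J..p + int J}"
      using assms(3)[of "j - p" s] that s by auto
    show "cmod (l2c0_nth x j t) \<le> b" if "j \<in> {p - int J..p + int J}"
      using assms(3)[of "j - p" s] assms(4)[of "j - p" s] that s \<open>0 \<le> b\<close>
      by (cases "s \<in> K") auto
  qed simp
  then show ?thesis by simp
qed

text \<open>
  Only finitely many entries matter up to a small tail, and each of them is soft-thresholded:
  \<open>z \<mapsto> (\<bar>z\<bar> - d)\<^sup>+ z / \<bar>z\<bar>\<close> moves every value by at most \<open>d\<close> and kills the values of modulus below \<open>d\<close>,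
  which leaves a compact support.
\<close>

lemma ex_supported_in_near:
  fixes f :: "'a::topological_space l2c0"
  assumes "e > 0"
  shows "\<exists>J K x. compact K \<and> supported_in J K x \<and> norm (f - x) < e"
proof -
  have "e / 4 > 0" using assms by simp
  then obtain F0 where F0: "finite F0"
      "\<And>F t. finite F \<Longrightarrow> F \<inter> F0 = {} \<Longrightarrow> L2_set (\<lambda>j. cmod (l2c0_nth f j t)) F \<le> e / 4"
    by (rule l2c0_seqs_tailE[OF l2c0_nth[of f]]) (rule that)
  \<comment> \<open>The denominator makes the thresholding error of the entries in \<open>F0\<close> at most \<open>e / 4\<close> in total.\<close>
  define d where "d = e / (4 * (real (card F0) + 1))"
  have d: "d > 0" using assms by (simp add: d_def add_nonneg_pos)
  have "\<exists>K. compact K \<and> (\<forall>t. t \<notin> K \<longrightarrow> cmod (l2c0_nth f j t) < d)" for j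
    using l2c0_nth[of f] d by (auto simp: l2c0_seqs_def c0fun_def)
  then obtain K where K: "\<And>j. compact (K j)" "\<And>j t. t \<notin> K j \<Longrightarrow> cmod (l2c0_nth f j t) < d"
    by metis
  define L where "L = (\<Union>j\<in>F0. K j)"
  have L: "compact L" unfolding L_def using F0(1) K(1) by (intro compact_UN) auto
  \<comment> \<open>The two maxima make soft-thresholding a continuous expression, also at \<open>0\<close>.\<close>
  define F where "F j t = (if j \<in> F0
      then of_real (max 0 (cmod (l2c0_nth f j t) - d) / max d (cmod (l2c0_nth f j t))) * l2c0_nth f j t
      else 0)" for j t
  have "\<exists>x. \<forall>j t. l2c0_nth x j t = F j t"
  proof (rule ex_l2c0_nth[OF F0(1) L])
    show "continuous_on UNIV (F j)" for j
    proof (cases "j \<in> F0")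
      case True
      have "max d (cmod (l2c0_nth f j t)) \<noteq> 0" for t using d by linarith
      with True show ?thesis
        unfolding F_def by (simp, intro continuous_intros) auto
    qed (simp add: F_def)
    show "F j t = 0" if "j \<notin> F0 \<or> t \<notin> L" for j t
      using that K(2)[of t j] by (auto simp: F_def L_def)
  qed
  then obtain x where x: "\<And>j t. l2c0_nth x j t = F j t" by blast
  have close: "cmod (l2c0_nth f j t - l2c0_nth x j t) \<le> d" if j: "j \<in> F0" for j t
  proof (cases "cmod (l2c0_nth f j t) \<le> d")
    case True
    then show ?thesis using j by (simp add: x F_def)
  next
    case False
    define a where "a = l2c0_nth f j t"
    have a: "cmod a > d" using False by (simp add: a_def)
    have a0: "a \<noteq> 0" using a d by auto
    have "a - of_real ((cmod a - d) / cmod a) * a = of_real (d / cmod a) * a"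
      using a0 by (simp add: field_simps)
    then have "cmod (a - of_real ((cmod a - d) / cmod a) * a) = d"
      using a0 d by (simp add: norm_mult norm_divide)
    then show ?thesis using j a by (simp add: x F_def a_def[symmetric] max_def)
  qed
  have "norm (f - x) \<le> e / 4 + real (card F0) * d"
    unfolding norm_l2c0_le_iff
  proof (intro allI impI)
    fix F :: "int set" and t assume F: "finite F"
    let ?g = "\<lambda>j. cmod (l2c0_nth (f - x) j t)"
    have "L2_set ?g F \<le>
        L2_set (\<lambda>j. if j \<in> F0 then 0 else ?g j) F + L2_set (\<lambda>j. if j \<in> F0 then ?g j else 0) F"
      by (rule order_trans[OF _ L2_set_triangle_ineq], rule L2_set_mono) auto
    moreover have "L2_set (\<lambda>j. if j \<in> F0 then 0 else ?g j) F \<le> e / 4"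
    proof -
      have "L2_set (\<lambda>j. if j \<in> F0 then 0 else ?g j) F = L2_set (\<lambda>j. cmod (l2c0_nth f j t)) (F - F0)"
      proof -
        have "(\<Sum>j\<in>F. (if j \<in> F0 then 0 else ?g j)\<^sup>2) = (\<Sum>j\<in>F - F0. (cmod (l2c0_nth f j t))\<^sup>2)"
          using F by (intro sum.mono_neutral_cong_right) (auto simp: x F_def)
        then show ?thesis by (simp add: L2_set_def)
      qed
      also have "\<dots> \<le> e / 4" using F by (intro F0(2)) auto
      finally show ?thesis .
    qed
    moreover have "L2_set (\<lambda>j. if j \<in> F0 then ?g j else 0) F \<le> real (card F0) * d"
    proof -
      have "L2_set (\<lambda>j. if j \<in> F0 then ?g j else 0) F \<le> (\<Sum>j\<in>F. if j \<in> F0 then ?g j else 0)"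
        by (rule L2_set_le_sum) simp
      also have "\<dots> = (\<Sum>j\<in>F \<inter> F0. ?g j)"
        using F by (rule sum.inter_restrict[symmetric])
      also have "\<dots> \<le> (\<Sum>j\<in>F0. ?g j)"
        using F0(1) by (intro sum_mono2) auto
      also have "\<dots> \<le> real (card F0) * d"
        using close by (intro sum_bounded_above) auto
      finally show ?thesis .
    qed
    ultimately show "L2_set ?g F \<le> e / 4 + real (card F0) * d" by linarith
  qed
  also have "real (card F0) * d \<le> e / 4"
    using assms by (simp add: d_def field_simps)
  then have "e / 4 + real (card F0) * d < e" using assms by linarith
  finally have near: "norm (f - x) < e" .
  obtain J where J: "\<And>j. j \<in> F0 \<Longrightarrow> \<bar>j\<bar> \<le> int J"
  proof
    fix j assume "j \<in> F0"
    with F0(1) have "\<bar>j\<bar> \<le> Max (abs ` F0)" by (intro Max_ge) auto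
    then show "\<bar>j\<bar> \<le> int (nat (Max (abs ` F0)))" by linarith
  qed
  have "supported_in J L x"
    unfolding supported_in_def x
  proof (intro allI impI)
    fix j t assume "j \<notin> {- int J..int J} \<or> t \<notin> L"
    then have "j \<notin> F0 \<or> t \<notin> L" using J[of j] by auto
    then show "F j t = 0"
      using K(2)[of t j] by (auto simp: F_def L_def)
  qed
  with L near show ?thesis by blast
qed

lemma ex_supported_in_open:
  fixes U :: "'a::topological_space l2c0 set"
  assumes "open U" "U \<noteq> {}"
  shows "\<exists>J K x. compact K \<and> supported_in J K x \<and> x \<in> U"
proof -
  obtain f e where "e > 0" "ball f e \<subseteq> U"
    using assms by (meson equals0I open_contains_ball)
  with ex_supported_in_near[of e f] show ?thesis
    by (metis dist_norm mem_ball subsetD)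
qed

text \<open>
  The test vector for necessity, from Urysohn's lemma: by local compactness, \<open>K\<close> has an open neighbourhood
  with compact closure, outside of which the bump function vanishes.
\<close>

lemma ex_plateau:
  fixes K :: "'a::t2_space set"
  assumes lc: "locally_compact_space (euclidean :: 'a topology)" and K: "compact K"
  shows "\<exists>x. (\<forall>j t. j \<notin> {- int J..int J} \<longrightarrow> l2c0_nth x j t = 0) \<and>
    (\<forall>j\<in>{- int J..int J}. \<forall>t\<in>K. l2c0_nth x j t = 1)"
proof -
  have H: "Hausdorff_space (euclidean :: 'a topology)"
    unfolding Hausdorff_space_def
    by simp (metis disjnt_def hausdorff)
  obtain U L where UL: "open U" "compact L" "K \<subseteq> U" "U \<subseteq> L"
    using lc K H by (auto simp: locally_compact_space_compact_closed_compact)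
  have cr: "completely_regular_space (euclidean :: 'a topology)"
    using lc H by (intro locally_compact_regular_imp_completely_regular_space) auto
  obtain h :: "'a \<Rightarrow> real" where h: "continuous_map euclidean (top_of_set {0..1}) h"
      "h ` (- U) \<subseteq> {0}" "h ` K \<subseteq> {1}"
    by (rule Urysohn_completely_regular_compact_closed[OF zero_le_one cr, of K "- U"])
       (use UL K in \<open>auto simp: disjnt_def closed_def intro: compact_imp_closed\<close>)
  have cont: "continuous_on UNIV h"
    using h(1) by (auto simp: continuous_map_in_subtopology)
  define F :: "int \<Rightarrow> 'a \<Rightarrow> complex" where
    "F j t = (if j \<in> {- int J..int J} then of_real (h t) else 0)" for j t
  have "\<exists>x. \<forall>j t. l2c0_nth x j t = F j t"
  proof (rule ex_l2c0_nth[OF _ UL(2)])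
    show "continuous_on UNIV (F j)" for j
      unfolding F_def
      by (cases "j \<in> {- int J..int J}") (auto intro!: continuous_intros cont)
    show "F j t = 0" if "j \<notin> {- int J..int J} \<or> t \<notin> L" for j t
      using that h(2) UL(4) by (auto simp: F_def)
  qed simp
  then obtain x where "\<And>j t. l2c0_nth x j t = F j t" by blast
  with h(3) show ?thesis
    by (intro exI[of _ x]) (auto simp: F_def)
qed

section \<open>Suprema, null sequences and uniform constants\<close>

lemma sup_over_upper:
  fixes K :: "'a::topological_space set"
  assumes "compact K" "continuous_on UNIV f" "t \<in> K"
  shows "f t \<le> sup_over K f"
proof -
  have "compact (f ` K)"
    using assms by (intro compact_continuous_image) (auto intro: continuous_on_subset)
  then have "bdd_above (f ` K)"
    by (intro bounded_imp_bdd_above compact_imp_bounded)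
  with assms(3) show ?thesis
    by (auto simp: sup_over_def intro: cSUP_upper)
qed

lemma sup_over_least: "0 \<le> b \<Longrightarrow> (\<And>t. t \<in> K \<Longrightarrow> f t \<le> b) \<Longrightarrow> sup_over K f \<le> b"
  by (auto simp: sup_over_def intro: cSUP_least)

lemma sup_over_nonneg:
  fixes K :: "'a::topological_space set"
  assumes "compact K" "continuous_on UNIV f" "\<And>t. t \<in> K \<Longrightarrow> 0 \<le> f t"
  shows "0 \<le> sup_over K f"
proof (cases "K = {}")
  case False
  then obtain t where "t \<in> K" by blast
  with sup_over_upper[OF assms(1,2)] assms(3) show ?thesis by (meson order_trans)
qed (simp add: sup_over_def)

text \<open>
  Finitely many quantities can be made small simultaneously along arbitrarily large \<open>n\<close> if and only if they
  tend to \<open>0\<close> along a common subsequence. This removes the subsequences from the weight conditions.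
\<close>

lemma null_sequences_iff_frequently_small:
  fixes q :: "'i \<Rightarrow> nat \<Rightarrow> real"
  assumes "finite I" and nonneg: "\<And>i n. i \<in> I \<Longrightarrow> 0 \<le> q i n"
  shows "(\<exists>n. strict_mono n \<and> (\<forall>k. 1 \<le> n k) \<and> (\<forall>i\<in>I. (\<lambda>k. q i (n k)) \<longlonglongrightarrow> 0)) \<longleftrightarrow>
    (\<forall>e>0. \<forall>m. \<exists>n\<ge>m. \<forall>i\<in>I. q i n \<le> e)"
proof
  assume "\<exists>n. strict_mono n \<and> (\<forall>k. 1 \<le> n k) \<and> (\<forall>i\<in>I. (\<lambda>k. q i (n k)) \<longlonglongrightarrow> 0)"
  then obtain n where n: "strict_mono n" "\<And>i. i \<in> I \<Longrightarrow> (\<lambda>k. q i (n k)) \<longlonglongrightarrow> 0" by blast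
  show "\<forall>e>0. \<forall>m. \<exists>n\<ge>m. \<forall>i\<in>I. q i n \<le> e"
  proof (intro allI impI)
    fix e :: real and m :: nat assume "e > 0"
    have "\<forall>\<^sub>F k in sequentially. \<forall>i\<in>I. q i (n k) < e"
      using n(2) \<open>e > 0\<close> by (intro eventually_ball_finite[OF assms(1)] ballI order_tendstoD(2))
    then obtain k0 where k0: "\<And>k i. k \<ge> k0 \<Longrightarrow> i \<in> I \<Longrightarrow> q i (n k) < e"
      unfolding eventually_sequentially by blast
    have "m \<le> n (max k0 m)"
      using seq_suble[OF n(1), of "max k0 m"] by simp
    with k0[of "max k0 m"] show "\<exists>n\<ge>m. \<forall>i\<in>I. q i n \<le> e"
      by (intro exI[of _ "n (max k0 m)"]) (auto intro: less_imp_le)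
  qed
next
  assume small: "\<forall>e>0. \<forall>m. \<exists>n\<ge>m. \<forall>i\<in>I. q i n \<le> e"
  let ?P = "\<lambda>k n. 1 \<le> n \<and> (\<forall>i\<in>I. q i n \<le> 1 / real (Suc k))"
  have "\<exists>f. \<forall>k. ?P k (f k) \<and> f k < f (Suc k)"
  proof (rule dependent_nat_choice)
    show "\<exists>x. ?P 0 x" using small[rule_format, of "1" 1] by auto
    fix x k
    obtain y where "y \<ge> Suc x" "\<forall>i\<in>I. q i y \<le> 1 / real (Suc (Suc k))"
      using small[rule_format, of "1 / real (Suc (Suc k))" "Suc x"] by auto
    then show "\<exists>y. ?P (Suc k) y \<and> x < y"
      by (intro exI[of _ y]) auto
  qed
  then obtain n where n: "\<And>k. ?P k (n k)" "\<And>k. n k < n (Suc k)" by blast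
  have "(\<lambda>k. q i (n k)) \<longlonglongrightarrow> 0" if "i \<in> I" for i
  proof (rule tendsto_sandwich[of "\<lambda>_. 0" _ _ "\<lambda>k. 1 / real (Suc k)"])
    show "(\<lambda>k. 1 / real (Suc k)) \<longlonglongrightarrow> 0"
      using LIMSEQ_inverse_real_of_nat by (simp add: inverse_eq_divide)
  qed (use that n(1) nonneg in auto)
  with n show "\<exists>n. strict_mono n \<and> (\<forall>k. 1 \<le> n k) \<and> (\<forall>i\<in>I. (\<lambda>k. q i (n k)) \<longlonglongrightarrow> 0)"
    by (intro exI[of _ n]) (auto simp: strict_mono_Suc_iff)
qed

lemma ex_common_radius:
  fixes P :: "'i \<Rightarrow> real \<Rightarrow> bool"
  assumes "finite I" and "\<And>i. i \<in> I \<Longrightarrow> \<exists>d>0. P i d"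
    and "\<And>i d d'. i \<in> I \<Longrightarrow> P i d \<Longrightarrow> d' \<le> d \<Longrightarrow> P i d'"
  shows "\<exists>d>0. \<forall>i\<in>I. P i d"
proof -
  have "\<forall>i\<in>I. \<exists>d. d > 0 \<and> P i d" using assms(2) by blast
  from bchoice[OF this] obtain d where d: "\<And>i. i \<in> I \<Longrightarrow> d i > 0 \<and> P i (d i)" by blast
  let ?d = "Min (insert 1 (d ` I))"
  have "?d > 0" using assms(1) d by (subst Min_gr_iff) auto
  moreover have "P i ?d" if "i \<in> I" for i
  proof (rule assms(3)[OF that])
    show "P i (d i)" using d[OF that] by simp
    show "?d \<le> d i" using assms(1) that by (intro Min_le) auto
  qed
  ultimately show ?thesis by blast
qed

lemma ex_uniform_lower_bound:
  fixes f :: "'i \<Rightarrow> 'a::topological_space \<Rightarrow> real"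
  assumes "finite I" "compact K"
    and "\<And>i. i \<in> I \<Longrightarrow> continuous_on UNIV (f i)" "\<And>i t. i \<in> I \<Longrightarrow> f i t > 0"
  shows "\<exists>d>0. \<forall>i\<in>I. \<forall>t\<in>K. d \<le> f i t"
proof (rule ex_common_radius[OF assms(1)])
  fix i assume i: "i \<in> I"
  show "\<exists>d>0. \<forall>t\<in>K. d \<le> f i t"
  proof (cases "K = {}")
    case False
    have "continuous_on K (f i)"
      using assms(3)[OF i] by (rule continuous_on_subset) simp
    then obtain s where "s \<in> K" "\<forall>t\<in>K. f i s \<le> f i t"
      using continuous_attains_inf[OF assms(2) False] by blast
    then show ?thesis using assms(4)[OF i] by blast
  qed (simp add: exI[of _ 1])
qed (meson order_trans)

text \<open>
  With \<open>A\<close> the largest \<open>a i\<close>, the choice \<open>c = e / A\<close> works, since \<open>d k \<le> e\<^sup>2 / A = e c\<close>. If all \<open>a i\<close> are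
  \<open>0\<close>, any sufficiently large \<open>c\<close> will do.
\<close>

lemma ex_balancing_scalar:
  fixes a :: "'i \<Rightarrow> real" and d :: "'k \<Rightarrow> real"
  assumes "finite I" "finite L" "e > 0"
    and "\<And>i. i \<in> I \<Longrightarrow> 0 \<le> a i" and "\<And>k. k \<in> L \<Longrightarrow> 0 \<le> d k"
    and prod: "\<And>i k. i \<in> I \<Longrightarrow> k \<in> L \<Longrightarrow> a i * d k \<le> e\<^sup>2"
  shows "\<exists>c>0. (\<forall>i\<in>I. c * a i \<le> e) \<and> (\<forall>k\<in>L. d k \<le> e * c)"
proof (cases "\<exists>i\<in>I. a i > 0")
  case True
  define A where "A = Max (a ` I)"
  have A: "A \<in> a ` I" "\<And>i. i \<in> I \<Longrightarrow> a i \<le> A"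
    unfolding A_def using True assms(1) by (auto intro: Max_in)
  have "A > 0" using True A(2) by force
  have "e / A * a i \<le> e" if "i \<in> I" for i
    using A(2)[OF that] \<open>A > 0\<close> \<open>e > 0\<close> by (simp add: field_simps)
  moreover have "d k \<le> e * (e / A)" if "k \<in> L" for k
  proof -
    from A(1) obtain i where "i \<in> I" "a i = A" by blast
    then have "A * d k \<le> e\<^sup>2" using prod[of i k] that by simp
    then show ?thesis using \<open>A > 0\<close> by (simp add: field_simps power2_eq_square)
  qed
  ultimately show ?thesis
    using \<open>A > 0\<close> \<open>e > 0\<close> by (intro exI[of _ "e / A"]) auto
next
  case False
  then have a: "\<And>i. i \<in> I \<Longrightarrow> a i = 0" using assms(4) by force
  define c where "c = (\<Sum>k\<in>L. d k) / e + 1"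
  have s: "(\<Sum>k\<in>L. d k) \<ge> 0" using assms(5) by (rule sum_nonneg)
  then have "c > 0" using \<open>e > 0\<close> by (simp add: c_def add_nonneg_pos)
  moreover have "d k \<le> e * c" if "k \<in> L" for k
  proof -
    have "d k \<le> (\<Sum>k\<in>L. d k)" using that assms(2,5) by (intro member_le_sum) auto
    also have "\<dots> \<le> e * c" using \<open>e > 0\<close> by (simp add: c_def field_simps)
    finally show ?thesis .
  qed
  ultimately show ?thesis using a \<open>e > 0\<close> by (intro exI[of _ c]) auto
qed

section \<open>One weighted shift\<close>

text \<open>
  The factor that the shift by \<open>R\<close> puts on the entry \<open>j\<close> at the point \<open>t\<close> of its argument, whereas
  \<^const>\<open>shift_weight\<close> is indexed by the entry and the point of the result.
\<close>

definition forward_weight ::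
  "('a \<Rightarrow> 'a) \<Rightarrow> (int \<Rightarrow> 'a::topological_space \<Rightarrow>\<^sub>C real) \<Rightarrow> nat \<Rightarrow> int \<Rightarrow> 'a \<Rightarrow> real" where
  "forward_weight \<alpha> w R j t = (\<Prod>i=1..R. w (j + int i) ((inv \<alpha> ^^ i) t))"

text \<open>
  Both sides are the product of \<open>h 0, \<dots>, h R\<close>.
\<close>

lemma prod_shift_index:
  fixes h :: "nat \<Rightarrow> real"
  shows "(\<Prod>i=1..R. h i) * h 0 = (\<Prod>i=1..R. h (i - 1)) * h R"
  by (induction R) (simp_all add: mult_ac)

lemma continuous_on_funpow:
  fixes f :: "'a::topological_space \<Rightarrow> 'a"
  assumes "continuous_on UNIV f"
  shows "continuous_on UNIV (f ^^ m)"
proof (induction m)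
  case (Suc m)
  then show ?case
    using continuous_on_compose2[OF assms, of UNIV "f ^^ m"] by (simp add: comp_def)
qed (simp add: id_def)

locale positive_weighted_homeo =
  fixes \<alpha> :: "'a::t2_space \<Rightarrow> 'a" and w :: "int \<Rightarrow> 'a \<Rightarrow>\<^sub>C real" and M :: real
  assumes hom: "homeomorphic_map euclidean euclidean \<alpha>"
    and w_pos: "\<And>j t. w j t > 0"
    and w_bound: "\<And>j. norm (w j) \<le> M"
begin

lemma bij: "bij \<alpha>"
proof -
  obtain \<beta> where "\<And>x. \<beta> (\<alpha> x) = x" "\<And>x. \<alpha> (\<beta> x) = x"
    using hom by (auto simp: homeomorphic_map_maps homeomorphic_maps_def)
  then show ?thesis by (intro o_bij[of \<beta>]) auto
qed

lemma cont: "continuous_on UNIV (\<alpha> ^^ m)"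
  using hom by (intro continuous_on_funpow) (auto simp: homeomorphic_map_maps homeomorphic_maps_def)

lemma cont_inv: "continuous_on UNIV (inv \<alpha> ^^ m)"
proof (rule continuous_on_funpow)
  obtain \<beta> where \<beta>: "continuous_on UNIV \<beta>" "\<And>x. \<beta> (\<alpha> x) = x"
    using hom by (auto simp: homeomorphic_map_maps homeomorphic_maps_def)
  have "inv \<alpha> = \<beta>"
    using \<beta>(2) bij by (metis bij_inv_eq_iff ext)
  with \<beta>(1) show "continuous_on UNIV (inv \<alpha>)" by simp
qed

lemma funpow_inv [simp]: "(\<alpha> ^^ m) ((inv \<alpha> ^^ m) t) = t"
  by (induction m arbitrary: t) (simp_all add: funpow_swap1[of \<alpha>] surj_f_inv_f bij bij_is_surj)

lemma inv_funpow [simp]: "(inv \<alpha> ^^ m) ((\<alpha> ^^ m) t) = t"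
  by (induction m arbitrary: t) (simp_all add: funpow_swap1[of "inv \<alpha>"] inv_f_f bij bij_is_inj)

lemma surj_funpow: "surj (\<alpha> ^^ m)"
  by (metis funpow_inv surjI)

lemma surj_inv_funpow: "surj (inv \<alpha> ^^ m)"
  by (metis inv_funpow surjI)

lemma funpow_diff_inv:
  assumes "i \<le> R"
  shows "(\<alpha> ^^ (R - i)) ((inv \<alpha> ^^ R) t) = (inv \<alpha> ^^ i) t"
proof -
  have "inv \<alpha> ^^ R = (inv \<alpha> ^^ (R - i)) \<circ> (inv \<alpha> ^^ i)"
    using assms by (simp flip: funpow_add)
  then show ?thesis by simp
qed

lemma shift_weight_at_inv:
  "shift_weight \<alpha> w R (j + int R) ((inv \<alpha> ^^ R) t) = forward_weight \<alpha> w R j t"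
  unfolding shift_weight_def forward_weight_def
  by (intro prod.cong) (auto simp: funpow_diff_inv)

lemma M_pos: "M > 0"
proof -
  fix t :: 'a
  have "w 0 t \<le> norm (w 0)"
    using norm_bounded[of "w 0" t] by simp
  with w_pos[of 0 t] w_bound[of 0] show ?thesis by linarith
qed

lemma w_le: "w j t \<le> M"
  using norm_bounded[of "w j" t] w_bound[of j] by simp

lemma shift_weight_pos: "shift_weight \<alpha> w R j t > 0"
  unfolding shift_weight_def by (intro prod_pos) (simp add: w_pos)

lemma forward_weight_pos: "forward_weight \<alpha> w R j t > 0"
  unfolding forward_weight_def by (intro prod_pos) (simp add: w_pos)

lemma cont_shift_weight: "continuous_on UNIV (shift_weight \<alpha> w R j)"
proof -
  have "continuous_on UNIV (\<lambda>t. w i ((\<alpha> ^^ m) t))" for i m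
    by (rule continuous_on_compose2[OF continuous_on_apply_bcontfun[of UNIV] cont]) simp
  then show ?thesis
    unfolding shift_weight_def by (intro continuous_on_prod)
qed

lemma cont_forward_weight: "continuous_on UNIV (forward_weight \<alpha> w R j)"
proof -
  have "continuous_on UNIV (\<lambda>t. w i ((inv \<alpha> ^^ m) t))" for i m
    by (rule continuous_on_compose2[OF continuous_on_apply_bcontfun[of UNIV] cont_inv]) simp
  then show ?thesis
    unfolding forward_weight_def by (intro continuous_on_prod)
qed

lemma weighted_shift_nth:
  "l2c0_nth (weighted_shift \<alpha> w R a) j t =
    of_real (shift_weight \<alpha> w R j t) * l2c0_nth a (j - int R) ((\<alpha> ^^ R) t)"
  unfolding shift_weight_def by (rule weighted_shift_apply[OF hom w_bound])

lemma weighted_shift_nth_inv: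
  "l2c0_nth (weighted_shift \<alpha> w R a) (j + int R) ((inv \<alpha> ^^ R) t) =
    of_real (forward_weight \<alpha> w R j t) * l2c0_nth a j t"
  by (simp add: weighted_shift_nth shift_weight_at_inv)

text \<open>
  On vectors with support in a compact box, division by the weights and shifting back is a right inverse; the
  compact support keeps the quotient bounded although the weights need not be bounded away from \<open>0\<close>.
\<close>

lemma ex_weighted_shift_preimage:
  assumes "compact K" and supp: "supported_in J K g"
  shows "\<exists>y. weighted_shift \<alpha> w R y = g \<and>
    (\<forall>j t. l2c0_nth y (j - int R) ((\<alpha> ^^ R) t) = l2c0_nth g j t / of_real (shift_weight \<alpha> w R j t))"
proof -
  define F where "F i u = l2c0_nth g (i + int R) ((inv \<alpha> ^^ R) u) /
      of_real (shift_weight \<alpha> w R (i + int R) ((inv \<alpha> ^^ R) u))" for i u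
  have nz: "shift_weight \<alpha> w R j t \<noteq> 0" for j t
    using shift_weight_pos[of R j t] by simp
  have "\<exists>y. \<forall>i u. l2c0_nth y i u = F i u"
  proof (rule ex_l2c0_nth[of "{- int J - int R..int J - int R}" "(\<alpha> ^^ R) ` K"])
    show "compact ((\<alpha> ^^ R) ` K)"
      using cont assms(1) by (intro compact_continuous_image) (auto intro: continuous_on_subset)
    have c1: "continuous_on UNIV (\<lambda>u. l2c0_nth g i ((inv \<alpha> ^^ R) u))" for i
      by (rule continuous_on_compose2[OF continuous_on_apply_bcontfun[of UNIV] cont_inv]) simp
    have c2: "continuous_on UNIV (\<lambda>u. shift_weight \<alpha> w R i ((inv \<alpha> ^^ R) u))" for i
      by (rule continuous_on_compose2[OF cont_shift_weight cont_inv]) simp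
    show "continuous_on UNIV (F i)" for i
      unfolding F_def by (intro continuous_intros c1 c2) (simp add: nz)
    show "F i u = 0" if "i \<notin> {- int J - int R..int J - int R} \<or> u \<notin> (\<alpha> ^^ R) ` K" for i u
    proof -
      have "i + int R \<notin> {- int J..int J} \<or> (inv \<alpha> ^^ R) u \<notin> K"
        using that by (metis add_diff_cancel_right' atLeastAtMost_iff diff_mono diff_self funpow_inv
            image_eqI order_refl)
      then show ?thesis
        using supp by (auto simp: F_def supported_in_def)
    qed
  qed simp
  then obtain y where y: "\<And>i u. l2c0_nth y i u = F i u" by blast
  have "weighted_shift \<alpha> w R y = g"
    by (rule l2c0_eqI) (simp add: weighted_shift_nth y F_def nz)
  with y show ?thesis
    by (intro exI[of _ y]) (simp add: F_def)
qed

text \<open>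
  The factors of the weight at \<open>(j + 1, t)\<close> and at \<open>(j, \<alpha> t)\<close> run along the same diagonal of indices and
  points; the two products differ in one factor at each end. The same holds for the forward weights.
\<close>

lemma shift_weight_Suc_index:
  "shift_weight \<alpha> w R (j + 1) t * w (j + 1 - int R) ((\<alpha> ^^ R) t) =
    shift_weight \<alpha> w R j (\<alpha> t) * w (j + 1) t"
proof -
  let ?h = "\<lambda>i. w (j + 1 - int R + int i) ((\<alpha> ^^ (R - i)) t)"
  have "shift_weight \<alpha> w R j (\<alpha> t) = (\<Prod>i=1..R. ?h (i - 1))"
    unfolding shift_weight_def
  proof (rule prod.cong[OF refl])
    fix i assume "i \<in> {1..R}"
    then have "R - (i - 1) = Suc (R - i)" "j - int R + int i = j + 1 - int R + int (i - 1)" by auto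
    then show "w (j - int R + int i) ((\<alpha> ^^ (R - i)) (\<alpha> t)) = ?h (i - 1)"
      by (simp only: funpow_Suc_right o_apply)
  qed
  then show ?thesis
    using prod_shift_index[of ?h R] by (simp add: shift_weight_def)
qed

lemma forward_weight_Suc_index:
  "forward_weight \<alpha> w R (j + 1) t * w (j + 1) t =
    forward_weight \<alpha> w R j (\<alpha> t) * w (j + 1 + int R) ((inv \<alpha> ^^ R) t)"
proof -
  let ?h = "\<lambda>i. w (j + 1 + int i) ((inv \<alpha> ^^ i) t)"
  have "forward_weight \<alpha> w R j (\<alpha> t) = (\<Prod>i=1..R. ?h (i - 1))"
    unfolding forward_weight_def
  proof (rule prod.cong[OF refl])
    fix i assume "i \<in> {1..R}"
    then obtain k where k: "i = Suc k" by (cases i) auto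
    have "inv \<alpha> (\<alpha> t) = t" using bij by (simp add: bij_is_inj)
    then show "w (j + int i) ((inv \<alpha> ^^ i) (\<alpha> t)) = ?h (i - 1)"
      by (simp add: k funpow_Suc_right add_ac del: funpow.simps)
  qed
  then show ?thesis
    using prod_shift_index[of ?h R] by (simp add: forward_weight_def)
qed

text \<open>
  Of the two factors that are exchanged in a unit step along the diagonal, the one at the far end of the orbit
  is only known to be at most \<open>M\<close>, and the one near the starting point is at least \<open>d\<close>. Both weights profit from
  these two bounds in the same direction, and the constant does not depend on \<open>R\<close>. A step in the opposite direction
  would need a lower bound at the far end, which is not available.
\<close>

lemma weights_along_diagonal:
  assumes "d > 0" and "\<And>i k. i \<in> {j..j + int m} \<Longrightarrow> k \<le> m \<Longrightarrow> d \<le> w i ((\<alpha> ^^ k) t)"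
  shows "1 / shift_weight \<alpha> w R (j + int m) t \<le> (M / d) ^ m / shift_weight \<alpha> w R j ((\<alpha> ^^ m) t)"
    and "forward_weight \<alpha> w R (j + int m) t \<le> (M / d) ^ m * forward_weight \<alpha> w R j ((\<alpha> ^^ m) t)"
proof -
  have "1 / shift_weight \<alpha> w R (j + int m) t \<le> (M / d) ^ m / shift_weight \<alpha> w R j ((\<alpha> ^^ m) t) \<and>
    forward_weight \<alpha> w R (j + int m) t \<le> (M / d) ^ m * forward_weight \<alpha> w R j ((\<alpha> ^^ m) t)"
    using assms(2)
  proof (induction m arbitrary: t)
    case (Suc m)
    have IH: "1 / shift_weight \<alpha> w R (j + int m) (\<alpha> t)
          \<le> (M / d) ^ m / shift_weight \<alpha> w R j ((\<alpha> ^^ m) (\<alpha> t)) \<and>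
        forward_weight \<alpha> w R (j + int m) (\<alpha> t)
          \<le> (M / d) ^ m * forward_weight \<alpha> w R j ((\<alpha> ^^ m) (\<alpha> t))"
    proof (rule Suc.IH)
      fix i k assume "i \<in> {j..j + int m}" "k \<le> m"
      then show "d \<le> w i ((\<alpha> ^^ k) (\<alpha> t))"
        using Suc.prems[of i "Suc k"] by (simp add: funpow_swap1)
    qed
    let ?B = "shift_weight \<alpha> w R (j + int m + 1) t" and ?B' = "shift_weight \<alpha> w R (j + int m) (\<alpha> t)"
    let ?D = "forward_weight \<alpha> w R (j + int m + 1) t" and ?D' = "forward_weight \<alpha> w R (j + int m) (\<alpha> t)"
    let ?v = "w (j + int m + 1) t"
    have v: "d \<le> ?v" using Suc.prems[of "j + int m + 1" 0] by simp
    have B: "?B > 0" "?B' > 0" and D: "?D > 0" "?D' > 0"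
      by (rule shift_weight_pos forward_weight_pos)+
    have "?B' * d \<le> ?B' * ?v" using v B by simp
    also have "\<dots> = ?B * w (j + int m + 1 - int R) ((\<alpha> ^^ R) t)"
      by (rule shift_weight_Suc_index[symmetric])
    also have "\<dots> \<le> ?B * M" using w_le B by simp
    finally have "1 / ?B \<le> M / d * (1 / ?B')"
      using B \<open>d > 0\<close> by (simp add: field_simps)
    also have "\<dots> \<le> M / d * ((M / d) ^ m / shift_weight \<alpha> w R j ((\<alpha> ^^ m) (\<alpha> t)))"
      using IH M_pos \<open>d > 0\<close> by (intro mult_left_mono) auto
    finally have 1: "1 / ?B \<le> (M / d) ^ Suc m / shift_weight \<alpha> w R j ((\<alpha> ^^ Suc m) t)"
      by (simp add: funpow_swap1)
    have "?D * d \<le> ?D * ?v" using v D by simp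
    also have "\<dots> = ?D' * w (j + int m + 1 + int R) ((inv \<alpha> ^^ R) t)"
      by (rule forward_weight_Suc_index)
    also have "\<dots> \<le> ?D' * M" using w_le D by simp
    finally have "?D \<le> M / d * ?D'"
      using \<open>d > 0\<close> by (simp add: field_simps)
    also have "\<dots> \<le> M / d * ((M / d) ^ m * forward_weight \<alpha> w R j ((\<alpha> ^^ m) (\<alpha> t)))"
      using IH M_pos \<open>d > 0\<close> by (intro mult_left_mono) auto
    finally have 2: "?D \<le> (M / d) ^ Suc m * forward_weight \<alpha> w R j ((\<alpha> ^^ Suc m) t)"
      by (simp add: funpow_swap1)
    have "j + int (Suc m) = j + int m + 1" by simp
    with 1 2 show ?case by (simp only:)
  qed simp
  then show "1 / shift_weight \<alpha> w R (j + int m) t \<le> (M / d) ^ m / shift_weight \<alpha> w R j ((\<alpha> ^^ m) t)"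
    and "forward_weight \<alpha> w R (j + int m) t \<le> (M / d) ^ m * forward_weight \<alpha> w R j ((\<alpha> ^^ m) t)"
    by auto
qed

end

section \<open>Several weighted shifts\<close>

locale positive_weighted_homeos =
  fixes N :: nat and r :: "nat \<Rightarrow> nat" and \<alpha> :: "nat \<Rightarrow> 'a::t2_space \<Rightarrow> 'a"
    and w :: "nat \<Rightarrow> int \<Rightarrow> 'a \<Rightarrow>\<^sub>C real" and M :: real
  assumes weighted_homeo: "\<And>l. l \<in> {1..N} \<Longrightarrow> positive_weighted_homeo (\<alpha> l) (w l) M"
begin

abbreviation T :: "nat \<Rightarrow> nat \<Rightarrow> 'a l2c0 \<Rightarrow>\<^sub>L 'a l2c0" where
  "T n l \<equiv> weighted_shift (\<alpha> l) (w l) (r l * n)"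

abbreviation B :: "nat \<Rightarrow> nat \<Rightarrow> int \<Rightarrow> 'a \<Rightarrow> real" where
  "B n l \<equiv> shift_weight (\<alpha> l) (w l) (r l * n)"

abbreviation D :: "nat \<Rightarrow> nat \<Rightarrow> int \<Rightarrow> 'a \<Rightarrow> real" where
  "D n l \<equiv> forward_weight (\<alpha> l) (w l) (r l * n)"

text \<open>
  The factor by which \<open>T n l\<close>, applied after the right inverse of \<open>T n s\<close>, multiplies the entry \<open>j\<close> at the
  point \<open>t\<close>.
\<close>

definition cross_weight :: "nat \<Rightarrow> nat \<Rightarrow> nat \<Rightarrow> int \<Rightarrow> 'a \<Rightarrow> real" where
  "cross_weight n s l j t = D n l (j - int (r s * n)) ((\<alpha> s ^^ (r s * n)) t) / B n s j t"

definition weights_small :: "nat \<Rightarrow> 'a set \<Rightarrow> real \<Rightarrow> nat \<Rightarrow> bool" where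
  "weights_small J K e n \<longleftrightarrow> (\<forall>s\<in>{1..N}. \<forall>l\<in>{1..N}. \<forall>j\<in>{- int J..int J}.
    sup_over K (\<lambda>t. 1 / B n s j t) * sup_over K (D n l j) \<le> e \<and>
    (s \<noteq> l \<longrightarrow> sup_over K (cross_weight n s l j) \<le> e))"

lemma B_pos: "l \<in> {1..N} \<Longrightarrow> B n l j t > 0"
  using weighted_homeo positive_weighted_homeo.shift_weight_pos by blast

lemma D_pos: "l \<in> {1..N} \<Longrightarrow> D n l j t > 0"
  using weighted_homeo positive_weighted_homeo.forward_weight_pos by blast

lemma cont_D: "l \<in> {1..N} \<Longrightarrow> continuous_on UNIV (D n l j)"
  using weighted_homeo positive_weighted_homeo.cont_forward_weight by blast

lemma cont_inverse_B: "l \<in> {1..N} \<Longrightarrow> continuous_on UNIV (\<lambda>t. 1 / B n l j t)"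
  using B_pos[of l n j] positive_weighted_homeo.cont_shift_weight[OF weighted_homeo]
  by (intro continuous_intros) (auto simp: less_le)

lemma cross_weight_pos:
  "s \<in> {1..N} \<Longrightarrow> l \<in> {1..N} \<Longrightarrow> cross_weight n s l j t > 0"
  by (simp add: cross_weight_def B_pos D_pos)

lemma cont_cross_weight:
  assumes "s \<in> {1..N}" "l \<in> {1..N}"
  shows "continuous_on UNIV (cross_weight n s l j)"
proof -
  interpret s: positive_weighted_homeo "\<alpha> s" "w s" M by (rule weighted_homeo) fact
  have "continuous_on UNIV (\<lambda>t. D n l i ((\<alpha> s ^^ m) t))" for i m
    by (rule continuous_on_compose2[OF cont_D[OF assms(2)] s.cont]) simp
  then show ?thesis
    unfolding cross_weight_def using B_pos[OF assms(1), of n j] s.cont_shift_weight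
    by (intro continuous_intros) (auto simp: less_le)
qed

text \<open>
  The finite index set of \<open>null_sequences_iff_frequently_small\<close> collects both kinds of quantities: the flag is
  \<open>True\<close> for the products and \<open>False\<close> for the cross weights, which are only present for \<open>s \<noteq> l\<close>.
\<close>

lemma weights_null_sequence_iff:
  assumes K: "compact K"
  shows "(\<exists>n. strict_mono n \<and> (\<forall>k. n k \<ge> 1) \<and>
      (\<forall>j\<in>{- int J..int J}. \<forall>l\<in>{1..N}. \<forall>s\<in>{1..N}.
        (\<lambda>k. sup_over K (\<lambda>t. 1 / B (n k) s j t) * sup_over K (D (n k) l j)) \<longlonglongrightarrow> 0) \<and>
      (\<forall>s\<in>{1..N}. \<forall>l\<in>{1..N}. s \<noteq> l \<longrightarrow> (\<forall>j\<in>{- int J..int J}.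
        (\<lambda>k. sup_over K (cross_weight (n k) s l j)) \<longlonglongrightarrow> 0))) \<longleftrightarrow>
    (\<forall>e>0. \<forall>m. \<exists>n\<ge>m. weights_small J K e n)"
proof -
  define I where "I = {(s, l, j, b). s \<in> {1..N} \<and> l \<in> {1..N} \<and> j \<in> {- int J..int J} \<and> (b \<or> s \<noteq> l)}"
  define q where "q = (\<lambda>(s, l, j, b) n.
    if b then sup_over K (\<lambda>t. 1 / B n s j t) * sup_over K (D n l j)
    else sup_over K (cross_weight n s l j))"
  have "I \<subseteq> {1..N} \<times> {1..N} \<times> {- int J..int J} \<times> UNIV" by (auto simp: I_def)
  then have "finite I" by (rule finite_subset) simp
  moreover have "0 \<le> q i n" if i: "i \<in> I" for i n
  proof -
    obtain s l j b where eq: "i = (s, l, j, b)" by (cases i)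
    with i have sl: "s \<in> {1..N}" "l \<in> {1..N}" by (auto simp: I_def)
    have "0 \<le> sup_over K (\<lambda>t. 1 / B n s j t)" "0 \<le> sup_over K (D n l j)"
      "0 \<le> sup_over K (cross_weight n s l j)"
      using B_pos[OF sl(1)] D_pos[OF sl(2)] cross_weight_pos[OF sl]
      by (auto intro!: sup_over_nonneg K cont_inverse_B cont_D cont_cross_weight sl
          simp: less_imp_le)
    then show ?thesis by (simp add: q_def eq)
  qed
  ultimately have *: "(\<exists>n. strict_mono n \<and> (\<forall>k. 1 \<le> n k) \<and> (\<forall>i\<in>I. (\<lambda>k. q i (n k)) \<longlonglongrightarrow> 0)) \<longleftrightarrow>
      (\<forall>e>0. \<forall>m. \<exists>n\<ge>m. \<forall>i\<in>I. q i n \<le> e)"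
    by (rule null_sequences_iff_frequently_small)
  have I_all: "(\<forall>i\<in>I. P i) \<longleftrightarrow> (\<forall>s\<in>{1..N}. \<forall>l\<in>{1..N}. \<forall>j\<in>{- int J..int J}.
      P (s, l, j, True) \<and> (s \<noteq> l \<longrightarrow> P (s, l, j, False)))" for P
    unfolding I_def by (simp add: Ball_def all_bool_eq del: atLeastAtMost_iff) blast
  have small_iff: "(\<forall>i\<in>I. q i n \<le> e) \<longleftrightarrow> weights_small J K e n" for e n
    by (simp only: I_all q_def prod.case if_True if_False weights_small_def)
  have 1: "(\<forall>e>0. \<forall>m. \<exists>n\<ge>m. \<forall>i\<in>I. q i n \<le> e) \<longleftrightarrow>
      (\<forall>e>0. \<forall>m. \<exists>n\<ge>m. weights_small J K e n)"
    by (intro all_cong1 imp_cong ex_cong1 conj_cong refl small_iff)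
  have 2: "(\<forall>i\<in>I. (\<lambda>k. q i (n k)) \<longlonglongrightarrow> 0) \<longleftrightarrow>
      (\<forall>j\<in>{- int J..int J}. \<forall>l\<in>{1..N}. \<forall>s\<in>{1..N}.
        (\<lambda>k. sup_over K (\<lambda>t. 1 / B (n k) s j t) * sup_over K (D (n k) l j)) \<longlonglongrightarrow> 0) \<and>
      (\<forall>s\<in>{1..N}. \<forall>l\<in>{1..N}. s \<noteq> l \<longrightarrow> (\<forall>j\<in>{- int J..int J}.
        (\<lambda>k. sup_over K (cross_weight (n k) s l j)) \<longlonglongrightarrow> 0))" for n
    by (simp only: I_all q_def prod.case if_True if_False) blast
  show ?thesis
    using * unfolding 1 2 .
qed

section \<open>Necessity of the weight conditions\<close>

text \<open>
  If both \<open>x = c y\<close> and the images \<open>T n l y\<close> are close to the plateau, then \<open>1 / B \<le> 2 \<epsilon> / c\<close> and \<open>D \<le> 2 \<epsilon> c\<close>: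
  the unknown scalar \<open>c\<close> cancels in the product, which is why the weight condition is about products.
\<close>

lemma weights_small_if_semi_transitive:
  assumes lc: "locally_compact_space (euclidean :: 'a topology)"
    and r_pos: "\<And>l. l \<in> {1..N} \<Longrightarrow> 1 \<le> r l" and r_inj: "inj_on r {1..N}"
    and trans: "d_semi_transitive infinite_subsets N T"
    and K: "compact K" and "e > 0"
  shows "\<exists>n\<ge>m. weights_small J K e n"
proof -
  obtain f :: "'a l2c0" where f0: "\<And>j t. j \<notin> {- int J..int J} \<Longrightarrow> l2c0_nth f j t = 0"
    and f1: "\<And>j t. j \<in> {- int J..int J} \<Longrightarrow> t \<in> K \<Longrightarrow> l2c0_nth f j t = 1"
    using ex_plateau[OF lc K] by blast
  define \<epsilon> where "\<epsilon> = min (1 / 2) (e / 4)"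
  have \<epsilon>: "\<epsilon> > 0" "\<epsilon> \<le> 1 / 2" "4 * \<epsilon> \<le> e" using \<open>e > 0\<close> by (auto simp: \<epsilon>_def)
  have "open (ball f \<epsilon>) \<and> ball f \<epsilon> \<noteq> {} \<and> (\<forall>l\<in>{1..N}. open (ball f \<epsilon>) \<and> ball f \<epsilon> \<noteq> {})"
    using \<epsilon>(1) by auto
  then obtain F where F: "F \<in> infinite_subsets"
    and hit: "\<And>n. n \<in> F \<Longrightarrow> \<exists>c>0.
      ball f \<epsilon> \<inter> (\<Inter>l\<in>{1..N}. (\<lambda>x. c *\<^sub>R x) ` (blinfun_apply (T n l) -` ball f \<epsilon>)) \<noteq> {}"
    using trans unfolding d_semi_transitive_def by meson
  from F obtain n where n: "n \<in> F" "n \<ge> m" "n > 2 * J"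
    unfolding infinite_subsets_def infinite_nat_iff_unbounded
    by (auto dest!: spec[of _ "max m (2 * J)"])
  obtain c x where c: "c > 0" and x: "x \<in> ball f \<epsilon>"
    and Tx: "\<And>l. l \<in> {1..N} \<Longrightarrow> x \<in> (\<lambda>x. c *\<^sub>R x) ` (blinfun_apply (T n l) -` ball f \<epsilon>)"
    using hit[OF n(1)] by blast
  define y where "y = x /\<^sub>R c"
  have xy: "x = c *\<^sub>R y" using c by (simp add: y_def)
  have near: "cmod (c *\<^sub>R l2c0_nth y i u - l2c0_nth f i u) < \<epsilon>" for i u
  proof -
    have "norm (x - f) < \<epsilon>" using x by (simp add: dist_norm norm_minus_commute)
    with cmod_le_norm_l2c0[of "x - f" i u] show ?thesis by (simp add: xy)
  qed
  have T_near: "cmod (l2c0_nth (T n l y) i u - l2c0_nth f i u) < \<epsilon>" if l: "l \<in> {1..N}" for l i u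
  proof -
    from Tx[OF l] obtain z where z: "x = c *\<^sub>R z" "T n l z \<in> ball f \<epsilon>" by blast
    then have "z = y" using c by (simp add: y_def)
    with z(2) have "norm (T n l y - f) < \<epsilon>" by (simp add: dist_norm norm_minus_commute)
    with cmod_le_norm_l2c0[of "T n l y - f" i u] show ?thesis by simp
  qed
  \<comment> \<open>Translation by a non-zero multiple of \<open>n\<close> moves the block off itself, because \<open>n > 2 J\<close>. With \<open>a\<close> or \<open>b\<close>
    equal to \<open>0\<close> this is the translation by a single \<open>r l * n\<close>.\<close>
  have far: "j + (int (a * n) - int (b * n)) \<notin> {- int J..int J}"
    if "a \<noteq> b" "j \<in> {- int J..int J}" for a b :: nat and j
  proof -
    have "1 \<le> \<bar>int a - int b\<bar>" using \<open>a \<noteq> b\<close> by simp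
    then have "1 * int n \<le> \<bar>int a - int b\<bar> * int n" by (intro mult_right_mono) auto
    then have "int n \<le> \<bar>(int a - int b) * int n\<bar>" by (simp add: abs_mult)
    then have "int n \<le> \<bar>int (a * n) - int (b * n)\<bar>" by (simp add: algebra_simps)
    with n(3) that(2) show ?thesis by auto
  qed
  have half: "1 / 2 \<le> cmod z" if "cmod (z - 1) < \<epsilon>" for z
    using norm_triangle_ineq2[of 1 z] that \<epsilon>(2) by (simp add: norm_minus_commute)
  have inverse_B: "1 / B n s j t \<le> 2 * cmod (l2c0_nth y (j - int (r s * n)) ((\<alpha> s ^^ (r s * n)) t))"
    "1 / B n s j t \<le> 2 * \<epsilon> / c"
    if s: "s \<in> {1..N}" and j: "j \<in> {- int J..int J}" and t: "t \<in> K" for s j t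
  proof -
    interpret s: positive_weighted_homeo "\<alpha> s" "w s" M by (rule weighted_homeo) fact
    let ?y = "l2c0_nth y (j - int (r s * n)) ((\<alpha> s ^^ (r s * n)) t)"
    have B: "B n s j t > 0" by (rule B_pos[OF s])
    have "1 / 2 \<le> cmod (of_real (B n s j t) * ?y)"
      using T_near[OF s, of j t] f1[OF j t] by (intro half) (simp add: s.weighted_shift_nth)
    then show le: "1 / B n s j t \<le> 2 * cmod ?y"
      using B by (simp add: norm_mult field_simps)
    have "j - int (r s * n) \<notin> {- int J..int J}"
      using far[of 0 "r s" j] r_pos[OF s] j by simp
    then have "c * cmod ?y < \<epsilon>"
      using near[of "j - int (r s * n)" "(\<alpha> s ^^ (r s * n)) t"] f0 c by simp
    then have "2 * cmod ?y \<le> 2 * \<epsilon> / c" using c by (simp add: field_simps)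
    with le show "1 / B n s j t \<le> 2 * \<epsilon> / c" by linarith
  qed
  have D_le: "D n l j t \<le> 2 * \<epsilon> * c"
    if l: "l \<in> {1..N}" and j: "j \<in> {- int J..int J}" and t: "t \<in> K" for l j t
  proof -
    interpret l: positive_weighted_homeo "\<alpha> l" "w l" M by (rule weighted_homeo) fact
    have D: "D n l j t > 0" by (rule D_pos[OF l])
    have "1 / 2 \<le> cmod (c *\<^sub>R l2c0_nth y j t)"
      using near[of j t] f1[OF j t] by (intro half) simp
    then have y: "1 \<le> 2 * c * cmod (l2c0_nth y j t)" using c by simp
    have "j + int (r l * n) \<notin> {- int J..int J}"
      using far[of "r l" 0 j] r_pos[OF l] j by simp
    then have "D n l j t * cmod (l2c0_nth y j t) < \<epsilon>"
      using T_near[OF l, of "j + int (r l * n)" "(inv (\<alpha> l) ^^ (r l * n)) t"] f0 D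
      by (simp add: l.weighted_shift_nth_inv norm_mult del: of_nat_mult)
    then have "2 * c * (D n l j t * cmod (l2c0_nth y j t)) \<le> 2 * c * \<epsilon>" using c by simp
    moreover have "D n l j t * 1 \<le> D n l j t * (2 * c * cmod (l2c0_nth y j t))"
      using D y by (intro mult_left_mono) auto
    ultimately show ?thesis by (simp add: mult_ac)
  qed
  have cross_le: "cross_weight n s l j t \<le> 2 * \<epsilon>"
    if s: "s \<in> {1..N}" and l: "l \<in> {1..N}" and "s \<noteq> l" and j: "j \<in> {- int J..int J}" and t: "t \<in> K"
    for s l j t
  proof -
    interpret l: positive_weighted_homeo "\<alpha> l" "w l" M by (rule weighted_homeo) fact
    let ?i = "j - int (r s * n)" and ?u = "(\<alpha> s ^^ (r s * n)) t"
    have D: "D n l ?i ?u > 0" by (rule D_pos[OF l])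
    have "r l \<noteq> r s" using r_inj s l \<open>s \<noteq> l\<close> by (auto dest: inj_onD)
    then have "?i + int (r l * n) \<notin> {- int J..int J}"
      using far[of "r l" "r s" j] j by (simp add: algebra_simps)
    then have small: "D n l ?i ?u * cmod (l2c0_nth y ?i ?u) < \<epsilon>"
      using T_near[OF l, of "?i + int (r l * n)" "(inv (\<alpha> l) ^^ (r l * n)) ?u"] f0 D
      by (simp add: l.weighted_shift_nth_inv norm_mult del: of_nat_mult)
    have "cross_weight n s l j t = D n l ?i ?u * (1 / B n s j t)"
      by (simp add: cross_weight_def)
    also have "\<dots> \<le> D n l ?i ?u * (2 * cmod (l2c0_nth y ?i ?u))"
      using D inverse_B(1)[OF s j t] by (intro mult_left_mono) auto
    also have "\<dots> \<le> 2 * \<epsilon>" using small by simp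
    finally show ?thesis .
  qed
  have "weights_small J K e n"
    unfolding weights_small_def
  proof (intro ballI conjI impI)
    fix s l j assume s: "s \<in> {1..N}" and l: "l \<in> {1..N}" and j: "j \<in> {- int J..int J}"
    have "sup_over K (\<lambda>t. 1 / B n s j t) * sup_over K (D n l j) \<le> (2 * \<epsilon> / c) * (2 * \<epsilon> * c)"
    proof (intro mult_mono)
      show "sup_over K (\<lambda>t. 1 / B n s j t) \<le> 2 * \<epsilon> / c"
        using \<epsilon>(1) c by (intro sup_over_least inverse_B(2)[OF s j]) auto
      show "sup_over K (D n l j) \<le> 2 * \<epsilon> * c"
        using \<epsilon>(1) c by (intro sup_over_least D_le[OF l j]) auto
      show "0 \<le> sup_over K (D n l j)"
        using D_pos[OF l] by (intro sup_over_nonneg K cont_D l) (auto simp: less_imp_le)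
    qed (use \<epsilon>(1) c in auto)
    also have "\<dots> = 4 * \<epsilon> * \<epsilon>" using c by simp
    also have "\<dots> \<le> 4 * \<epsilon> * 1" using \<epsilon> by (intro mult_left_mono) auto
    finally show "sup_over K (\<lambda>t. 1 / B n s j t) * sup_over K (D n l j) \<le> e" using \<epsilon>(3) by simp
    show "sup_over K (cross_weight n s l j) \<le> e" if "s \<noteq> l"
    proof (rule sup_over_least)
      show "cross_weight n s l j t \<le> e" if "t \<in> K" for t
        using cross_le[OF s l \<open>s \<noteq> l\<close> j that] \<epsilon> by linarith
    qed (use \<open>e > 0\<close> in simp)
  qed
  with n(2) show ?thesis by blast
qed

section \<open>Sufficiency of the weight conditions\<close>

text \<open>
  The witness is \<open>f + c (\<Sum>s. y s)\<close> with \<open>T n s (y s) = g s\<close>. Each of the vectors \<open>c y s\<close>, \<open>T n l (f / c)\<close> and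
  \<open>T n l (y s)\<close> for \<open>s \<noteq> l\<close> has at most \<open>2 J + 1\<close> non-zero entries, all bounded by \<open>e G\<close>.
\<close>

lemma ex_approximate_preimage:
  fixes g :: "nat \<Rightarrow> 'a l2c0"
  assumes "compact K" and f: "supported_in J K f" and g: "\<And>l. l \<in> {1..N} \<Longrightarrow> supported_in J K (g l)"
    and G: "\<And>j t. cmod (l2c0_nth f j t) \<le> G"
      "\<And>l j t. l \<in> {1..N} \<Longrightarrow> cmod (l2c0_nth (g l) j t) \<le> G"
    and "c > 0" "0 \<le> e"
    and B: "\<And>s j t. s \<in> {1..N} \<Longrightarrow> j \<in> {- int J..int J} \<Longrightarrow> t \<in> K \<Longrightarrow> c * (1 / B n s j t) \<le> e"
    and D: "\<And>l j t. l \<in> {1..N} \<Longrightarrow> j \<in> {- int J..int J} \<Longrightarrow> t \<in> K \<Longrightarrow> D n l j t \<le> e * c"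
    and Q: "\<And>s l j t. s \<in> {1..N} \<Longrightarrow> l \<in> {1..N} \<Longrightarrow> s \<noteq> l \<Longrightarrow> j \<in> {- int J..int J} \<Longrightarrow> t \<in> K \<Longrightarrow>
      cross_weight n s l j t \<le> e"
  shows "\<exists>x. norm (x - f) \<le> real (N + 1) * ((2 * real J + 1) * (e * G)) \<and>
    (\<forall>l\<in>{1..N}. norm (T n l (x /\<^sub>R c) - g l) \<le> real (N + 1) * ((2 * real J + 1) * (e * G)))"
proof -
  define b where "b = (2 * real J + 1) * (e * G)"
  have "G \<ge> 0" using G(1) norm_ge_zero order_trans by blast
  with \<open>0 \<le> e\<close> have eG: "e * G \<ge> 0" and b0: "b \<ge> 0" by (simp_all add: b_def)
  have "\<exists>y. \<forall>s\<in>{1..N}. T n s (y s) = g s \<and>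
      (\<forall>j t. l2c0_nth (y s) (j - int (r s * n)) ((\<alpha> s ^^ (r s * n)) t)
        = l2c0_nth (g s) j t / of_real (B n s j t))"
    using positive_weighted_homeo.ex_weighted_shift_preimage[OF weighted_homeo \<open>compact K\<close> g]
    by (intro bchoice) blast
  then obtain y where Ty: "\<And>s. s \<in> {1..N} \<Longrightarrow> T n s (y s) = g s"
    and y: "\<And>s j t. s \<in> {1..N} \<Longrightarrow> l2c0_nth (y s) (j - int (r s * n)) ((\<alpha> s ^^ (r s * n)) t)
        = l2c0_nth (g s) j t / of_real (B n s j t)"
    by blast
  have small_y: "norm (c *\<^sub>R y s) \<le> b" if s: "s \<in> {1..N}" for s
    unfolding b_def
  proof (rule norm_l2c0_le_reindexed)
    interpret s: positive_weighted_homeo "\<alpha> s" "w s" M by (rule weighted_homeo) fact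
    show "surj (\<alpha> s ^^ (r s * n))" by (rule s.surj_funpow)
    fix j t
    have eq: "l2c0_nth (c *\<^sub>R y s) (j + - int (r s * n)) ((\<alpha> s ^^ (r s * n)) t)
        = c *\<^sub>R (l2c0_nth (g s) j t / of_real (B n s j t))"
      using y[OF s, of j t] by simp
    show "l2c0_nth (c *\<^sub>R y s) (j + - int (r s * n)) ((\<alpha> s ^^ (r s * n)) t) = 0"
      if "j \<notin> {- int J..int J} \<or> t \<notin> K"
      using that g[OF s] unfolding eq supported_in_def by simp
    assume "j \<in> {- int J..int J}" "t \<in> K"
    then have "c * (1 / B n s j t) * cmod (l2c0_nth (g s) j t) \<le> e * G"
      using B[OF s] G(2)[OF s] \<open>0 \<le> e\<close> by (intro mult_mono) auto
    then show "cmod (l2c0_nth (c *\<^sub>R y s) (j + - int (r s * n)) ((\<alpha> s ^^ (r s * n)) t)) \<le> e * G"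
      unfolding eq using \<open>c > 0\<close> B_pos[OF s, of n j t] by (simp add: norm_divide)
  qed (rule eG)
  have small_f: "norm (T n l (f /\<^sub>R c)) \<le> b" if l: "l \<in> {1..N}" for l
    unfolding b_def
  proof (rule norm_l2c0_le_reindexed)
    interpret l: positive_weighted_homeo "\<alpha> l" "w l" M by (rule weighted_homeo) fact
    show "surj (inv (\<alpha> l) ^^ (r l * n))" by (rule l.surj_inv_funpow)
    fix j t
    have eq: "l2c0_nth (T n l (f /\<^sub>R c)) (j + int (r l * n)) ((inv (\<alpha> l) ^^ (r l * n)) t)
        = of_real (D n l j t) * (l2c0_nth f j t /\<^sub>R c)"
      by (simp only: l.weighted_shift_nth_inv l2c0_nth_simps scaleR_bcontfun.rep_eq)
    show "l2c0_nth (T n l (f /\<^sub>R c)) (j + int (r l * n)) ((inv (\<alpha> l) ^^ (r l * n)) t) = 0"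
      if "j \<notin> {- int J..int J} \<or> t \<notin> K"
      using that f unfolding eq supported_in_def by simp
    assume jt: "j \<in> {- int J..int J}" "t \<in> K"
    have "D n l j t / c \<le> e" using D[OF l jt] \<open>c > 0\<close> by (simp add: field_simps)
    then have "D n l j t / c * cmod (l2c0_nth f j t) \<le> e * G"
      using G(1) \<open>0 \<le> e\<close> by (intro mult_mono) auto
    then show "cmod (l2c0_nth (T n l (f /\<^sub>R c)) (j + int (r l * n))
        ((inv (\<alpha> l) ^^ (r l * n)) t)) \<le> e * G"
      unfolding eq using \<open>c > 0\<close> D_pos[OF l, of n j t]
      by (simp add: norm_mult divide_inverse mult_ac)
  qed (rule eG)
  have small_cross: "norm (T n l (y s)) \<le> b"
    if s: "s \<in> {1..N}" and l: "l \<in> {1..N}" and "s \<noteq> l" for s l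
    unfolding b_def
  proof (rule norm_l2c0_le_reindexed)
    interpret s: positive_weighted_homeo "\<alpha> s" "w s" M by (rule weighted_homeo) fact
    interpret l: positive_weighted_homeo "\<alpha> l" "w l" M by (rule weighted_homeo) fact
    \<comment> \<open>At these coordinates \<open>T n l (y s)\<close> has the entries of \<open>g s\<close>, multiplied by the cross weights.\<close>
    let ?\<sigma> = "(inv (\<alpha> l) ^^ (r l * n)) \<circ> (\<alpha> s ^^ (r s * n))"
    let ?p = "int (r l * n) - int (r s * n)"
    show "surj ?\<sigma>" by (rule comp_surj[OF s.surj_funpow l.surj_inv_funpow])
    fix j t
    have "j + ?p = (j - int (r s * n)) + int (r l * n)" by simp
    then have eq: "l2c0_nth (T n l (y s)) (j + ?p) (?\<sigma> t)
        = of_real (cross_weight n s l j t) * l2c0_nth (g s) j t"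
      by (simp only: o_apply l.weighted_shift_nth_inv y[OF s]) (simp add: cross_weight_def)
    show "l2c0_nth (T n l (y s)) (j + ?p) (?\<sigma> t) = 0"
      if "j \<notin> {- int J..int J} \<or> t \<notin> K"
      using that g[OF s] unfolding eq supported_in_def by simp
    assume jt: "j \<in> {- int J..int J}" "t \<in> K"
    have "cross_weight n s l j t * cmod (l2c0_nth (g s) j t) \<le> e * G"
      using Q[OF s l \<open>s \<noteq> l\<close> jt] G(2)[OF s] \<open>0 \<le> e\<close> by (intro mult_mono) auto
    then show "cmod (l2c0_nth (T n l (y s)) (j + ?p) (?\<sigma> t)) \<le> e * G"
      unfolding eq using cross_weight_pos[OF s l, of n j t] by (simp add: norm_mult)
  qed (rule eG)
  define x where "x = f + (\<Sum>s=1..N. c *\<^sub>R y s)"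
  have "norm (x - f) \<le> (\<Sum>s=1..N. norm (c *\<^sub>R y s))"
    unfolding x_def by (simp only: add_diff_cancel_left' norm_sum)
  also have "\<dots> \<le> real (card {1..N}) * b"
    by (rule sum_bounded_above) (rule small_y)
  also have "\<dots> \<le> real (N + 1) * b" using b0 by (simp add: mult_right_mono)
  finally have near_f: "norm (x - f) \<le> real (N + 1) * b" .
  have near_g: "norm (T n l (x /\<^sub>R c) - g l) \<le> real (N + 1) * b" if l: "l \<in> {1..N}" for l
  proof -
    have "x /\<^sub>R c = f /\<^sub>R c + (\<Sum>s=1..N. y s)"
      using \<open>c > 0\<close> by (simp add: x_def scaleR_add_right scaleR_sum_right)
    then have "T n l (x /\<^sub>R c) = T n l (f /\<^sub>R c) + (\<Sum>s=1..N. T n l (y s))"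
      by (simp only: blinfun.add_right blinfun.sum_right)
    also have "(\<Sum>s=1..N. T n l (y s)) = g l + (\<Sum>s\<in>{1..N} - {l}. T n l (y s))"
      using l by (simp add: sum.remove Ty)
    finally have "norm (T n l (x /\<^sub>R c) - g l)
        = norm (T n l (f /\<^sub>R c) + (\<Sum>s\<in>{1..N} - {l}. T n l (y s)))" by simp
    also have "\<dots> \<le> norm (T n l (f /\<^sub>R c)) + (\<Sum>s\<in>{1..N} - {l}. norm (T n l (y s)))"
      by (intro order_trans[OF norm_triangle_ineq] add_mono norm_sum order_refl)
    also have "\<dots> \<le> b + real (card ({1..N} - {l})) * b"
      using small_f[OF l] small_cross l by (intro add_mono sum_bounded_above) auto
    also have "\<dots> \<le> b + real N * b"
      using b0 l by (intro add_left_mono mult_right_mono) simp_all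
    also have "\<dots> = real (N + 1) * b" by (simp add: algebra_simps)
    finally show ?thesis .
  qed
  from near_f near_g show ?thesis unfolding b_def by blast
qed

text \<open>
  The products are estimated by those at the index \<open>-J\<close> over the enlarged compact set \<open>K'\<close>; the constant \<open>C\<close> is
  the price for moving the other indices of the box there.
\<close>

lemma semi_transitive_if_weights_small:
  assumes small: "\<And>J K e m. 1 \<le> J \<Longrightarrow> compact K \<Longrightarrow> e > 0 \<Longrightarrow> \<exists>n\<ge>m. weights_small J K e n"
  shows "d_semi_transitive infinite_subsets N T"
  unfolding d_semi_transitive_def
proof (intro allI impI)
  fix U :: "'a l2c0 set" and V :: "nat \<Rightarrow> 'a l2c0 set"
  assume UV: "open U \<and> U \<noteq> {} \<and> (\<forall>l\<in>{1..N}. open (V l) \<and> V l \<noteq> {})"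
  have "\<exists>J K x. compact K \<and> supported_in J K x \<and> x \<in> U"
    using UV by (intro ex_supported_in_open) simp_all
  then obtain J0 K0 f where f0: "compact K0" "supported_in J0 K0 f" "f \<in> U" by blast
  have "\<forall>l\<in>{1..N}. \<exists>J K x. compact K \<and> supported_in J K x \<and> x \<in> V l"
    using UV by (intro ballI ex_supported_in_open) simp_all
  from bchoice[OF this] obtain J1 where
    "\<forall>l\<in>{1..N}. \<exists>K x. compact K \<and> supported_in (J1 l) K x \<and> x \<in> V l" by (rule exE)
  from bchoice[OF this] obtain K1 where
    "\<forall>l\<in>{1..N}. \<exists>x. compact (K1 l) \<and> supported_in (J1 l) (K1 l) x \<and> x \<in> V l" by (rule exE)
  from bchoice[OF this] obtain g where p: "\<And>l. l \<in> {1..N} \<Longrightarrow>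
      compact (K1 l) \<and> supported_in (J1 l) (K1 l) (g l) \<and> g l \<in> V l" by blast
  define J where "J = 1 + J0 + (\<Sum>l=1..N. J1 l)"
  define K where "K = K0 \<union> (\<Union>l\<in>{1..N}. K1 l)"
  have K: "compact K"
    unfolding K_def using f0(1) p by (intro compact_Un compact_UN) auto
  have f: "supported_in J K f"
    using f0(2) by (rule supported_in_mono) (auto simp: J_def K_def)
  have g: "supported_in J K (g l)" if l: "l \<in> {1..N}" for l
  proof (rule supported_in_mono)
    show "supported_in (J1 l) (K1 l) (g l)" using p[OF l] by simp
    have "J1 l \<le> (\<Sum>l=1..N. J1 l)"
      using l by (intro member_le_sum) auto
    then show "J1 l \<le> J" by (simp add: J_def)
    show "K1 l \<subseteq> K" using l by (auto simp: K_def)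
  qed
  obtain r0 where r0: "r0 > 0" "ball f r0 \<subseteq> U"
    using UV f0(3) open_contains_ball by blast
  have "\<exists>d>0. \<forall>l\<in>{1..N}. ball (g l) d \<subseteq> V l"
  proof (rule ex_common_radius)
    show "\<exists>d>0. ball (g l) d \<subseteq> V l" if "l \<in> {1..N}" for l
      using UV p[OF that] that open_contains_ball by blast
  qed (auto simp: subset_iff)
  then obtain r1 where r1: "r1 > 0" "\<And>l. l \<in> {1..N} \<Longrightarrow> ball (g l) r1 \<subseteq> V l" by blast
  define \<rho> where "\<rho> = min r0 r1"
  have \<rho>: "\<rho> > 0" "ball f \<rho> \<subseteq> U" "\<And>l. l \<in> {1..N} \<Longrightarrow> ball (g l) \<rho> \<subseteq> V l"
    using r0 r1 by (auto simp: \<rho>_def subset_iff)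
  define G where "G = 1 + norm f + (\<Sum>l=1..N. norm (g l))"
  have G0: "G > 0" by (simp add: G_def add_pos_nonneg sum_nonneg)
  have Gf: "cmod (l2c0_nth f j t) \<le> G" for j t
    using cmod_le_norm_l2c0[of f j t] sum_nonneg[of "{1..N}" "\<lambda>l. norm (g l)"] by (simp add: G_def)
  have Gg: "cmod (l2c0_nth (g l) j t) \<le> G" if "l \<in> {1..N}" for l j t
  proof -
    have "norm (g l) \<le> (\<Sum>l=1..N. norm (g l))" using that by (intro member_le_sum) auto
    with cmod_le_norm_l2c0[of "g l" j t] show ?thesis
      unfolding G_def using norm_ge_zero[of f] by linarith
  qed
  \<comment> \<open>Chosen such that the error bound of \<open>ex_approximate_preimage\<close> is \<open>\<rho> / 2\<close>.\<close>
  define e where "e = \<rho> / (2 * (real (N + 1) * ((2 * real J + 1) * G)))"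
  have e0: "e > 0" using \<rho>(1) G0 by (simp add: e_def)
  have "real (N + 1) * ((2 * real J + 1) * (e * G)) = \<rho> / 2"
    using G0 by (simp add: e_def divide_simps)
  with \<rho>(1) have e_\<rho>: "real (N + 1) * ((2 * real J + 1) * (e * G)) < \<rho>" by simp
  \<comment> \<open>Contains the points reached from \<open>K\<close> when an index of the box is moved down to \<open>-J\<close>.\<close>
  define K' where "K' = K \<union> (\<Union>s\<in>{1..N}. \<Union>m\<in>{..2 * J}. (\<alpha> s ^^ m) ` K)"
  have K': "compact K'"
    unfolding K'_def
  proof (intro compact_Un K compact_UN finite_atLeastAtMost finite_atMost)
    fix s m assume "s \<in> {1..N}"
    then interpret s: positive_weighted_homeo "\<alpha> s" "w s" M by (rule weighted_homeo)
    show "compact ((\<alpha> s ^^ m) ` K)"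
      using s.cont K by (intro compact_continuous_image) (auto intro: continuous_on_subset)
  qed
  have "\<exists>d>0. \<forall>i\<in>{1..N} \<times> {- int J..int J}. \<forall>t\<in>K'. d \<le> w (fst i) (snd i) t"
    using positive_weighted_homeo.w_pos[OF weighted_homeo] K'
    by (intro ex_uniform_lower_bound) (auto intro: continuous_on_apply_bcontfun)
  then obtain d where d: "d > 0"
    "\<And>s i t. s \<in> {1..N} \<Longrightarrow> i \<in> {- int J..int J} \<Longrightarrow> t \<in> K' \<Longrightarrow> d \<le> w s i t"
    by (auto simp: Ball_def)
  define C where "C = max 1 (M / d) ^ (2 * J)"
  have C0: "C > 0" by (simp add: C_def)
  define A where "A n s = C * sup_over K' (\<lambda>t. 1 / B n s (- int J) t)" for n s
  define E where "E n l = C * sup_over K' (D n l (- int J))" for n l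
  have diagonal: "1 / B n s j t \<le> A n s" "D n s j t \<le> E n s"
    if s: "s \<in> {1..N}" and j: "j \<in> {- int J..int J}" and t: "t \<in> K" for n s j t
  proof -
    interpret s: positive_weighted_homeo "\<alpha> s" "w s" M by (rule weighted_homeo) fact
    define m where "m = nat (j + int J)"
    have m: "j = - int J + int m" "m \<le> 2 * J" using j by (auto simp: m_def)
    have orbit: "(\<alpha> s ^^ k) t \<in> K'" if "k \<le> m" for k
      unfolding K'_def using s t m(2) that by (intro UnI2 UN_I[of s] UN_I[of k]) auto
    have low: "d \<le> w s i ((\<alpha> s ^^ k) t)" if "i \<in> {- int J..- int J + int m}" "k \<le> m" for i k
      using that m(2) by (intro d(2) s orbit) auto
    have "(M / d) ^ m \<le> max 1 (M / d) ^ m"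
      using s.M_pos d(1) by (intro power_mono) auto
    also have "\<dots> \<le> C"
      unfolding C_def using m(2) by (intro power_increasing) auto
    finally have C: "(M / d) ^ m \<le> C" .
    have "1 / B n s (- int J + int m) t \<le> (M / d) ^ m / B n s (- int J) ((\<alpha> s ^^ m) t)"
      by (rule s.weights_along_diagonal(1)[OF d(1)], rule low)
    then have "1 / B n s j t \<le> (M / d) ^ m * (1 / B n s (- int J) ((\<alpha> s ^^ m) t))"
      using m(1) by simp
    also have "\<dots> \<le> A n s"
      unfolding A_def using C C0 B_pos[OF s]
      by (intro mult_mono sup_over_upper[OF K' cont_inverse_B[OF s]] orbit) (auto simp: less_imp_le)
    finally show "1 / B n s j t \<le> A n s" .
    have "D n s (- int J + int m) t \<le> (M / d) ^ m * D n s (- int J) ((\<alpha> s ^^ m) t)"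
      by (rule s.weights_along_diagonal(2)[OF d(1)], rule low)
    then have "D n s j t \<le> (M / d) ^ m * D n s (- int J) ((\<alpha> s ^^ m) t)"
      using m(1) by simp
    also have "\<dots> \<le> E n s"
      unfolding E_def using C C0 D_pos[OF s]
      by (intro mult_mono sup_over_upper[OF K' cont_D[OF s]] orbit) (auto simp: less_imp_le)
    finally show "D n s j t \<le> E n s" .
  qed
  \<comment> \<open>The factor \<open>1 / C\<^sup>2\<close> compensates the two factors \<open>C\<close> in \<open>A\<close> and \<open>E\<close>.\<close>
  define F where "F = {n. 1 \<le> n \<and> weights_small J K' (min e (e\<^sup>2 / C\<^sup>2)) n}"
  have "\<exists>n\<ge>m. n \<in> F" for m
    using small[of J K' "min e (e\<^sup>2 / C\<^sup>2)" "max 1 m"] K' e0 C0 by (auto simp: F_def J_def)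
  then have "F \<in> infinite_subsets"
    by (auto simp: infinite_subsets_def infinite_nat_iff_unbounded_le F_def)
  moreover have "\<exists>c>0. U \<inter> (\<Inter>l\<in>{1..N}. (\<lambda>x. c *\<^sub>R x) ` (blinfun_apply (T n l) -` V l)) \<noteq> {}"
    if "n \<in> F" for n
  proof -
    have n: "sup_over K' (\<lambda>t. 1 / B n s j t) * sup_over K' (D n l j) \<le> e\<^sup>2 / C\<^sup>2"
      "s \<noteq> l \<Longrightarrow> sup_over K' (cross_weight n s l j) \<le> e"
      if "s \<in> {1..N}" "l \<in> {1..N}" "j \<in> {- int J..int J}" for s l j
      using \<open>n \<in> F\<close> that by (auto simp: F_def weights_small_def)
    have "\<exists>c>0. (\<forall>s\<in>{1..N}. c * A n s \<le> e) \<and> (\<forall>l\<in>{1..N}. E n l \<le> e * c)"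
    proof (rule ex_balancing_scalar)
      show "0 \<le> A n s" if "s \<in> {1..N}" for s
        unfolding A_def using C0 B_pos[OF that]
        by (intro mult_nonneg_nonneg sup_over_nonneg K' cont_inverse_B that) (auto simp: less_imp_le)
      show "0 \<le> E n l" if "l \<in> {1..N}" for l
        unfolding E_def using C0 D_pos[OF that]
        by (intro mult_nonneg_nonneg sup_over_nonneg K' cont_D that) (auto simp: less_imp_le)
      show "A n s * E n l \<le> e\<^sup>2" if "s \<in> {1..N}" "l \<in> {1..N}" for s l
        using n(1)[OF that, of "- int J"] C0
        by (simp add: A_def E_def field_simps power2_eq_square)
    qed (use e0 in auto)
    then obtain c where c: "c > 0" "\<And>s. s \<in> {1..N} \<Longrightarrow> c * A n s \<le> e"
      "\<And>l. l \<in> {1..N} \<Longrightarrow> E n l \<le> e * c" by blast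
    have "\<exists>x. norm (x - f) \<le> real (N + 1) * ((2 * real J + 1) * (e * G)) \<and>
      (\<forall>l\<in>{1..N}. norm (T n l (x /\<^sub>R c) - g l) \<le> real (N + 1) * ((2 * real J + 1) * (e * G)))"
    proof (rule ex_approximate_preimage[OF K f g Gf Gg c(1) less_imp_le[OF e0]])
      fix s j t assume s: "s \<in> {1..N}" and j: "j \<in> {- int J..int J}" and t: "t \<in> K"
      have "c * (1 / B n s j t) \<le> c * A n s"
        using diagonal(1)[OF s j t] c(1) by (intro mult_left_mono) auto
      then show "c * (1 / B n s j t) \<le> e" using c(2)[OF s] by linarith
      show "D n s j t \<le> e * c" using diagonal(2)[OF s j t, of n] c(3)[OF s] by linarith
      fix l assume l: "l \<in> {1..N}" "s \<noteq> l"
      have "t \<in> K'" using t by (simp add: K'_def)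
      then show "cross_weight n s l j t \<le> e"
        using sup_over_upper[OF K' cont_cross_weight[OF s l(1)], of t n j] n(2)[OF s l(1) j l(2)]
        by linarith
    qed
    then obtain x where x: "norm (x - f) < \<rho>" "\<And>l. l \<in> {1..N} \<Longrightarrow> norm (T n l (x /\<^sub>R c) - g l) < \<rho>"
      using e_\<rho> by (meson le_less_trans)
    have "x \<in> U"
      using x(1) \<rho>(2) by (auto simp: dist_norm norm_minus_commute)
    moreover have "x \<in> (\<lambda>x. c *\<^sub>R x) ` (blinfun_apply (T n l) -` V l)" if l: "l \<in> {1..N}" for l
    proof (rule image_eqI)
      show "x = c *\<^sub>R (x /\<^sub>R c)" using c(1) by simp
      have "T n l (x /\<^sub>R c) \<in> ball (g l) \<rho>"
        using x(2)[OF l] by (simp add: dist_norm norm_minus_commute)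
      then show "x /\<^sub>R c \<in> blinfun_apply (T n l) -` V l"
        using \<rho>(3)[OF l] by blast
    qed
    ultimately show ?thesis using c(1) by blast
  qed
  ultimately show "\<exists>F\<in>infinite_subsets. \<forall>n\<in>F. \<exists>c>0.
      U \<inter> (\<Inter>l\<in>{1..N}. (\<lambda>x. c *\<^sub>R x) ` (blinfun_apply (T n l) -` V l)) \<noteq> {}"
    by blast
qed

end

section \<open>The characterisation\<close>

theorem corollary4p3:
  fixes N :: nat
    and r :: "nat \<Rightarrow> nat"
    and \<alpha> :: "nat \<Rightarrow> 'a::t2_space \<Rightarrow> 'a"
    and w :: "nat \<Rightarrow> int \<Rightarrow> 'a \<Rightarrow>\<^sub>C real"
  assumes "locally_compact_space (euclidean :: 'a topology)"
    and "\<not> compact (UNIV :: 'a set)"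
    and "N \<ge> 1"
    and "\<And>l. l \<in> {1..N} \<Longrightarrow> r l \<ge> 1"
    and "strict_mono_on {1..N} r"
    and "\<And>l. l \<in> {1..N} \<Longrightarrow> homeomorphic_map euclidean euclidean (\<alpha> l)"
    and "\<And>l j t. l \<in> {1..N} \<Longrightarrow> w l j t > 0"
    and "\<exists>M>0. \<forall>l\<in>{1..N}. \<forall>j. norm (w l j) < M"
  shows "d_semi_transitive infinite_subsets N (\<lambda>n l. weighted_shift (\<alpha> l) (w l) (r l * n)) \<longleftrightarrow>
    (\<forall>J\<ge>1. \<forall>K. compact K \<longrightarrow>
      (\<exists>n :: nat \<Rightarrow> nat. strict_mono n \<and> (\<forall>k. n k \<ge> 1) \<and>
        (\<forall>j\<in>{- int J..int J}. \<forall>l\<in>{1..N}. \<forall>s\<in>{1..N}.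
          (\<lambda>k. sup_over K (\<lambda>t. 1 / (\<Prod>i=1..r s * n k.
                   w s (j + int i - int (r s * n k)) ((\<alpha> s ^^ (r s * n k - i)) t))) *
               sup_over K (\<lambda>t. \<Prod>i=1..r l * n k.
                   w l (j + int i) ((inv (\<alpha> l) ^^ i) t)))
            \<longlonglongrightarrow> 0) \<and>
        (\<forall>s\<in>{1..N}. \<forall>l\<in>{1..N}. s \<noteq> l \<longrightarrow> (\<forall>j\<in>{- int J..int J}.
          (\<lambda>k. sup_over K (\<lambda>t.
                 (\<Prod>i=1..r l * n k. w l (j - int (r s * n k) + int i)
                    ((inv (\<alpha> l) ^^ i) ((\<alpha> s ^^ (r s * n k)) t))) /
                 (\<Prod>i=1..r s * n k. w s (j - int (r s * n k) + int i)
                    ((\<alpha> s ^^ (r s * n k - i)) t))))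
            \<longlonglongrightarrow> 0))))"
proof -
  obtain M where M: "\<And>l j. l \<in> {1..N} \<Longrightarrow> norm (w l j) < M"
    using assms(8) by blast
  interpret positive_weighted_homeos N r \<alpha> w M
    by unfold_locales (use assms(6,7) M in \<open>auto intro: less_imp_le\<close>)
  have B_eq: "(\<lambda>t. 1 / (\<Prod>i=1..R. w s (j + int i - int R) ((\<alpha> s ^^ (R - i)) t)))
      = (\<lambda>t. 1 / shift_weight (\<alpha> s) (w s) R j t)" for R s j
    by (simp add: shift_weight_def algebra_simps)
  have D_eq: "(\<lambda>t. \<Prod>i=1..r l * n. w l (j + int i) ((inv (\<alpha> l) ^^ i) t)) = D n l j" for n l j
    by (simp add: forward_weight_def fun_eq_iff)
  have cross_eq: "(\<lambda>t.
        (\<Prod>i=1..r l * n. w l (j - int (r s * n) + int i)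
          ((inv (\<alpha> l) ^^ i) ((\<alpha> s ^^ (r s * n)) t))) /
        (\<Prod>i=1..r s * n. w s (j - int (r s * n) + int i) ((\<alpha> s ^^ (r s * n - i)) t)))
      = cross_weight n s l j" for n s l j
    by (simp add: cross_weight_def forward_weight_def shift_weight_def fun_eq_iff)
  have "d_semi_transitive infinite_subsets N T \<longleftrightarrow>
      (\<forall>J\<ge>1. \<forall>K. compact K \<longrightarrow> (\<forall>e>0. \<forall>m. \<exists>n\<ge>m. weights_small J K e n))"
    using weights_small_if_semi_transitive[OF assms(1,4) strict_mono_on_imp_inj_on[OF assms(5)]]
      semi_transitive_if_weights_small by blast
  then show ?thesis
    unfolding B_eq D_eq cross_eq by (simp only: weights_null_sequence_iff cong: imp_cong)
qed

end
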